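(* Let $\mathbb{X}$ be a (finite or infinite dimensional) Hilbert space and $n\in\mathbb{N}$. Let $E\subseteq \mathbb{X}$ be a Borel set that is a countable union of sets $E_i$, each of which has Nagata dimension at most $n$. Then $E$ admits an $n$-dimensional pointwise weak tangent field.
   Context: Nagata dimension: let $M$ be a metric space. A covering $\mathcal{B}$ of $M$ is $r$-bounded if each set in it has diameter at most $r$. The $s$-multiplicity of $\mathcal{B}$ is the infimum of all integers $m$ such that every subset of $M$ with diameter at most $s$ meets at most $m$ sets from $\mathcal{B}$. The Nagata dimension of $M$ is the infimum of all integers $n$ such that there is a constant $c>0$ for which, for all $s>0$, $M$ admits a $cs$-bounded cover with $s$-multiplicity at most $n+1$. A rectifiable curve in $\mathbb{X}$ is a Lipschitz image of $[0,1]$, equivalently a compact connected set of finite one-dimensional Hausdorff measure $\mathcal{H}^1$. A rectifiable curve $\Gamma$ has a tangent line $\tau_\Gamma(p)$ (a one-dimensional linear subspace) at $\mathcal{H}^1$-a.e. $p\in\Gamma$; it can be defined by fixing an arc-length parametrization $\gamma$ of $\Gamma$ and letting $\tau_\Gamma(\gamma(t))$ be the span of $\gamma'(t)$. Let $\mathcal{L}_j$ denote the collection of $j$-dimensional linear subspaces of $\mathbb{X}$, with its natural topology (e.g. given by the distance between orthogonal projections in operator norm). For a Borel set $E\subseteq \mathbb{X}$ and an integer $k\ge 1$, a $k$-dimensional pointwise weak tangent field to $E$ is a Borel map $\tau\colon E\to\bigcup_{j=0}^k\mathcal{L}_j$ such that for every rectifiable curve $\Gamma$ in $\mathbb{X}$,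 $\tau_\Gamma(p)\subseteq\tau(p)$ for $\mathcal{H}^1$-a.e. $p\in\Gamma\cap E$. *)

theory Defs
  imports "HOL-Analysis.Analysis"
begin

section \<open>Nagata dimension\<close>

text \<open>
  A metric space is given as a subset \<open>S\<close> of a type, with the restricted distance.
  The library's \<^const>\<open>diameter\<close> is only meaningful on bounded sets, so ``diameter at
  most \<open>r\<close>'' always comes with \<^const>\<open>bounded\<close>.
\<close>

definition diam_le :: "'a::metric_space set \<Rightarrow> real \<Rightarrow> bool" where
  "diam_le A r \<longleftrightarrow> bounded A \<and> diameter A \<le> r"

definition bounded_cover :: "real \<Rightarrow> 'a::metric_space set \<Rightarrow> 'a set set \<Rightarrow> bool" where
  "bounded_cover r S \<B> \<longleftrightarrow> \<Union>\<B> = S \<and> (\<forall>B\<in>\<B>. diam_le B r)"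

definition multiplicity_at :: "real \<Rightarrow> 'a::metric_space set \<Rightarrow> 'a set set \<Rightarrow> enat" where
  "multiplicity_at s S \<B> =
     Inf {enat m | m. \<forall>A\<subseteq>S. diam_le A s \<longrightarrow>
            finite {B\<in>\<B>. B \<inter> A \<noteq> {}} \<and> card {B\<in>\<B>. B \<inter> A \<noteq> {}} \<le> m}"

text \<open>
  The infimum ranges over natural numbers, and is \<open>\<infinity>\<close> if no number qualifies. Allowing negative
  integers would only change the dimension of the empty set (from 0 to -1 or less).
\<close>

definition nagata_dim :: "'a::metric_space set \<Rightarrow> enat" where
  "nagata_dim S =
     Inf {enat n | n. \<exists>c>0. \<forall>s>0. \<exists>\<B>.
            bounded_cover (c * s) S \<B> \<and> multiplicity_at s S \<B> \<le> enat (n + 1)}"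


section \<open>One-dimensional Hausdorff measure\<close>

text \<open>As an outer measure on all subsets; \<open>U i = {}\<close> is allowed, so finite covers are included.\<close>

definition hausdorff1_premeasure :: "real \<Rightarrow> 'a::metric_space set \<Rightarrow> ennreal" where
  "hausdorff1_premeasure \<delta> A =
     (INF U\<in>{U :: nat \<Rightarrow> 'a set. A \<subseteq> (\<Union>i. U i) \<and> (\<forall>i. diam_le (U i) \<delta>)}.
        \<Sum>i. ennreal (diameter (U i)))"

definition hausdorff1 :: "'a::metric_space set \<Rightarrow> ennreal" where
  "hausdorff1 A = (SUP \<delta>\<in>{0<..}. hausdorff1_premeasure \<delta> A)"


section \<open>Rectifiable curves and their tangents\<close>

definition rectifiable_curve :: "'a::metric_space set \<Rightarrow> bool" where
  "rectifiable_curve \<Gamma> \<longleftrightarrow>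
     (\<exists>C (\<gamma> :: real \<Rightarrow> 'a). C-lipschitz_on {0..1} \<gamma> \<and> \<gamma> ` {0..1} = \<Gamma>)"

definition curve_length :: "(real \<Rightarrow> 'a::metric_space) \<Rightarrow> real \<Rightarrow> real \<Rightarrow> ennreal" where
  "curve_length \<gamma> a b =
     (SUP (n, t) \<in> {(n :: nat, t :: nat \<Rightarrow> real). t 0 = a \<and> t n = b \<and> mono_on {..n} t}.
        ennreal (\<Sum>i<n. dist (\<gamma> (t i)) (\<gamma> (t (Suc i)))))"

definition arclength_parametrization ::
    "real \<Rightarrow> (real \<Rightarrow> 'a::metric_space) \<Rightarrow> 'a set \<Rightarrow> bool" where
  "arclength_parametrization L \<gamma> \<Gamma> \<longleftrightarrow>
     0 \<le> L \<and> \<gamma> ` {0..L} = \<Gamma> \<and>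
     (\<forall>a b. 0 \<le> a \<longrightarrow> a \<le> b \<longrightarrow> b \<le> L \<longrightarrow> curve_length \<gamma> a b = ennreal (b - a))"

text \<open>
  An arc-length parametrization need not be injective, and need not be differentiable everywhere,
  so at exceptional points \<open>p\<close> the span below can fail to be a line. At \<open>\<H>\<^sup>1\<close>-almost every point
  \<open>p\<close> of the curve, however, the derivatives at the preimages of \<open>p\<close> exist, have norm 1 and
  agree up to sign, so that this is the line spanned by \<open>\<gamma>'(t)\<close> for any \<open>t\<close> with \<open>\<gamma> t = p\<close>.
\<close>

definition tangent_line :: "real \<Rightarrow> (real \<Rightarrow> 'a::real_normed_vector) \<Rightarrow> 'a \<Rightarrow> 'a set" where
  "tangent_line L \<gamma> p =
     span {v. \<exists>t\<in>{0<..<L}. \<gamma> t = p \<and> (\<gamma> has_vector_derivative v) (at t)}"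


section \<open>The space of linear subspaces of dimension at most \<open>k\<close>\<close>

text \<open>
  The library's \<^const>\<open>dim\<close> is 0 on infinite-dimensional subspaces, hence the explicit finite basis.
\<close>

definition subspaces_of_dim :: "nat \<Rightarrow> 'a::real_vector set set" where
  "subspaces_of_dim j = {V. \<exists>B. finite B \<and> independent B \<and> card B = j \<and> span B = V}"

definition subspaces_upto :: "nat \<Rightarrow> 'a::real_vector set set" where
  "subspaces_upto k = (\<Union>j\<le>k. subspaces_of_dim j)"

definition orth_proj :: "'a::real_inner set \<Rightarrow> 'a \<Rightarrow>\<^sub>L 'a" where
  "orth_proj V = Blinfun (\<lambda>x. THE y. y \<in> V \<and> (\<forall>v\<in>V. orthogonal (x - y) v))"

definition subspace_dist :: "'a::real_inner set \<Rightarrow> 'a set \<Rightarrow> real" where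
  "subspace_dist V W = norm (orth_proj V - orth_proj W)"

definition subspace_topology :: "nat \<Rightarrow> 'a::real_inner set topology" where
  "subspace_topology k = Metric_space.mtopology (subspaces_upto k) subspace_dist"

definition subspace_borel :: "nat \<Rightarrow> 'a::real_inner set measure" where
  "subspace_borel k = sigma (subspaces_upto k) {U. openin (subspace_topology k) U}"

text \<open>
  The descriptions through \<open>THE\<close> and \<^const>\<open>Blinfun\<close> are justified: on finite-dimensional
  subspaces \<^const>\<open>orth_proj\<close> is the orthogonal projection, and \<^const>\<open>subspace_dist\<close> is a metric.
\<close>

lemma orth_proj_unique:
  fixes V :: "'a::real_inner set"
  assumes "subspace V"
    and "y \<in> V" "\<forall>v\<in>V. orthogonal (x - y) v"
    and "z \<in> V" "\<forall>v\<in>V. orthogonal (x - z) v"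
  shows "y = z"
proof -
  have d: "y - z \<in> V" using assms by (simp add: subspace_diff)
  have "(x - z) \<bullet> (y - z) - (x - y) \<bullet> (y - z) = 0"
    using assms(3,5) d by (simp add: orthogonal_def)
  then have "(y - z) \<bullet> (y - z) = 0" by (simp add: inner_diff_left)
  then show ?thesis by simp
qed

lemma orth_proj_works:
  fixes V :: "'a::real_inner set"
  assumes "V \<in> subspaces_of_dim j"
  shows "blinfun_apply (orth_proj V) x \<in> V"
    and "v \<in> V \<Longrightarrow> orthogonal (x - blinfun_apply (orth_proj V) x) v"
proof -
  obtain B where B: "finite B" "span B = V"
    using assms by (auto simp: subspaces_of_dim_def)
  obtain C where C: "finite C" "span C = V" "pairwise orthogonal C"
    using basis_orthogonal[OF B(1)] B(2) by auto
  have sub: "subspace V" using C(2) by auto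
  define P where "P x = (\<Sum>b\<in>C. (x \<bullet> b / (b \<bullet> b)) *\<^sub>R b)" for x
  have inV: "P x \<in> V" for x
    unfolding P_def C(2)[symmetric] by (intro span_sum span_mul span_base)
  have orthC: "orthogonal (x - P x) c" if "c \<in> C" for x c
  proof -
    have "P x \<bullet> c = (\<Sum>b\<in>C. (x \<bullet> b / (b \<bullet> b)) * (b \<bullet> c))"
      by (simp add: P_def inner_sum_left)
    also have "\<dots> = (\<Sum>b\<in>C. if b = c then x \<bullet> c else 0)"
      using C(3) that by (intro sum.cong) (auto simp: pairwise_def orthogonal_def)
    also have "\<dots> = x \<bullet> c" using C(1) that by simp
    finally show ?thesis by (simp add: orthogonal_def inner_diff_left)
  qed
  have orth: "orthogonal (x - P x) v" if "v \<in> V" for x v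
    using that orthC orthogonal_to_span unfolding C(2)[symmetric] by blast
  have eq: "(THE y. y \<in> V \<and> (\<forall>v\<in>V. orthogonal (x - y) v)) = P x" for x
    using inV orth orth_proj_unique[OF sub] by (intro the_equality) blast+
  have "bounded_linear P"
    unfolding P_def divide_inverse by (intro bounded_linear_intros)
  then have "blinfun_apply (orth_proj V) = P"
    unfolding orth_proj_def eq by (simp add: bounded_linear_Blinfun_apply)
  then show "blinfun_apply (orth_proj V) x \<in> V"
    and "v \<in> V \<Longrightarrow> orthogonal (x - blinfun_apply (orth_proj V) x) v"
    using inV orth by auto
qed

lemma Metric_space_subspace_dist:
  "Metric_space (subspaces_upto k :: 'a::real_inner set set) subspace_dist"
proof
  fix V W Z :: "'a set"
  show "0 \<le> subspace_dist V W" by (simp add: subspace_dist_def)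
  show "subspace_dist V W = subspace_dist W V"
    by (simp add: subspace_dist_def norm_minus_commute)
  show "subspace_dist V Z \<le> subspace_dist V W + subspace_dist W Z"
    unfolding subspace_dist_def dist_norm[symmetric] by (rule dist_triangle)
  assume "V \<in> subspaces_upto k" "W \<in> subspaces_upto k"
  then obtain i j where VW: "V \<in> subspaces_of_dim i" "W \<in> subspaces_of_dim j"
    by (auto simp: subspaces_upto_def)
  have range: "range (blinfun_apply (orth_proj U)) = U" if U: "U \<in> subspaces_of_dim m"
    for U :: "'a set" and m
  proof -
    have sub: "subspace U" using U by (auto simp: subspaces_of_dim_def)
    have "blinfun_apply (orth_proj U) x = x" if "x \<in> U" for x
      using orth_proj_unique[OF sub, of _ x x] orth_proj_works[OF U] that
      by (auto simp: orthogonal_clauses)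
    then show ?thesis using orth_proj_works(1)[OF U] by (auto simp: image_iff) metis
  qed
  show "subspace_dist V W = 0 \<longleftrightarrow> V = W"
  proof
    assume "subspace_dist V W = 0"
    then have "orth_proj V = orth_proj W" by (simp add: subspace_dist_def)
    then show "V = W" using range VW by metis
  qed (simp add: subspace_dist_def)
qed


section \<open>Pointwise weak tangent fields\<close>

text \<open>
  The tangent condition is required for every arc-length parametrization of \<open>\<Gamma>\<close>; since different
  parametrizations have the same tangent lines \<open>\<H>\<^sup>1\<close>-almost everywhere, it does not depend on
  the choice.
\<close>

definition weak_tangent_field :: "nat \<Rightarrow> 'a::real_inner set \<Rightarrow> ('a \<Rightarrow> 'a set) \<Rightarrow> bool" where
  "weak_tangent_field k E \<tau> \<longleftrightarrow>
     \<tau> \<in> measurable (restrict_space borel E) (subspace_borel k) \<and>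
     (\<forall>\<Gamma>. rectifiable_curve \<Gamma> \<longrightarrow>
        (\<forall>L \<gamma>. arclength_parametrization L \<gamma> \<Gamma> \<longrightarrow>
           hausdorff1 {p \<in> \<Gamma> \<inter> E. \<not> tangent_line L \<gamma> p \<subseteq> \<tau> p} = 0))"

end

theory Submission
  imports Defs
begin

text \<open>
  For a set \<open>S\<close> and a point \<open>p\<close> let \<open>f w\<close> be the upper limit of \<open>dist (p + h w, S) / \<bar>h\<bar>\<close> as \<open>h\<close> tends to \<open>0\<close>, the
  rate at which \<open>S\<close> deviates from the line through \<open>p\<close> in direction \<open>w\<close> (\<open>deviation_le\<close>). The tangent
  space of \<open>S\<close> at \<open>p\<close> consists of the periods of this rate, the vectors \<open>v\<close> with \<open>f (w + v) \<le> f w\<close> for all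
  \<open>w\<close>. Since \<open>f\<close> is homogeneous, the periods form a linear subspace, and at points of the closure of \<open>S\<close> the
  rate vanishes on it.
  
  Curves see only periods. Let \<open>\<gamma>\<close> have derivative \<open>v\<close> at \<open>t\<close>, and suppose that \<open>S\<close> is followed in direction
  \<open>w\<close> at rate \<open>q\<close> from \<open>\<gamma> t\<close>. For almost every \<open>t\<close> the same holds, with uniform scale and almost the same \<open>q\<close>,
  from \<open>\<gamma> s\<close> for a set of parameters \<open>s\<close> whose gaps near \<open>t\<close> are negligible. Moving along the curve by \<open>h v\<close>
  and leaving it by \<open>h w\<close> shows that \<open>S\<close> is followed in direction \<open>w + v\<close> at rate \<open>q\<close>
  (\<open>curve_derivative_in_tangent_space\<close>). The exceptional null set comes from countably many directions
  \<open>w\<close> and rates \<open>q\<close>.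
  
  A set of Nagata dimension at most \<open>n\<close> has tangent spaces of dimension at most \<open>n\<close>. Along its tangent space
  the set is flat, so small balls of that space lie very close to the set relative to their radius, and
  the covers from the definition of the Nagata dimension contradict the Lebesgue covering theorem if the dimension exceeds \<open>n\<close>
  (\<open>nagata_dim_flat_bound\<close>). For a countable union, \<open>\<tau> p\<close> is the tangent space of the first set whose closure
  contains \<open>p\<close>.
  
  The space need not be separable, and then countably many directions cannot approximate all \<open>w\<close>. With
  respect to a fixed orthonormal basis, \<open>v\<close> and \<open>w\<close> are therefore restricted to the closed span of the
  basis vectors not orthogonal to \<open>p\<close>. A curve involves only countably many basis vectors. Where a
  coordinate of the curve vanishes, its derivative vanishes too, apart from a null set, so tangent
  vectors satisfy the restriction. These spans have dense sequences that depend on \<open>p\<close> in a locally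
  constant way on countably many Borel pieces (\<open>sigma_locally_constant\<close>). Distances from these sequences to
  the tangent space are Borel functions (\<open>infdist_tangent_space_le_iff\<close>), because the tangent space is a
  nested intersection of convex sets, and they determine the orthogonal projection onto it up to small errors
  in operator norm (\<open>tangent_space_measurable\<close>).
\<close>

section \<open>Sets of small Nagata dimension are not flat in many directions\<close>

text \<open>
  Colour the grid points of a cube by the members of a cover in which no member meets two opposite
  faces. Label \<open>x\<close> in coordinate \<open>j\<close> by whether its colour class meets the upper face \<open>x j = M\<close>. The
  labels depend on the colour only, so a simplex whose \<open>Suc N\<close> vertices carry all \<open>Suc N\<close> reduced
  labels, which Kuhn's parity argument provides, has vertices of \<open>Suc N\<close> different colours.
\<close>

lemma discrete_lebesgue_covering:
  fixes B :: "(nat \<Rightarrow> nat) \<Rightarrow> 'b" and M N :: nat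
  assumes "0 < M"
    and opposite: "\<And>x y j. \<lbrakk>\<forall>i. x i \<le> M; \<forall>i. y i \<le> M; j < N; x j = 0; y j = M\<rbrakk> \<Longrightarrow> B x \<noteq> B y"
  obtains C where "finite C" "\<And>x i. x \<in> C \<Longrightarrow> x i \<le> M"
    "\<And>x y i. x \<in> C \<Longrightarrow> y \<in> C \<Longrightarrow> x i \<le> Suc (y i)" "card (B ` C) \<ge> Suc N"
proof -
  define lab :: "(nat \<Rightarrow> nat) \<Rightarrow> nat \<Rightarrow> nat" where
    "lab x j = (if \<exists>y. (\<forall>i. y i \<le> M) \<and> y j = M \<and> B y = B x then 1 else 0)" for x j
  have "odd (card {s. ksimplex M N s \<and> (reduced N \<circ> lab) ` s = {..N}})"
  proof (rule kuhn_combinatorial[OF \<open>0 < M\<close>])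
    show "\<forall>x j. (\<forall>j. x j \<le> M) \<and> j < N \<and> x j = 0 \<longrightarrow> lab x j = 0"
      using opposite unfolding lab_def by metis
    show "\<forall>x j. (\<forall>j. x j \<le> M) \<and> j < N \<and> x j = M \<longrightarrow> lab x j = 1"
      unfolding lab_def by auto
  qed
  then have "{s. ksimplex M N s \<and> (reduced N \<circ> lab) ` s = {..N}} \<noteq> {}"
    by (rule odd_card_imp_not_empty)
  then obtain C b u where "kuhn_simplex M N b u C" and full: "(reduced N \<circ> lab) ` C = {..N}"
    by (auto elim: ksimplex.cases)
  interpret kuhn_simplex M N b u C by fact
  have "lab x = lab y" if "B x = B y" for x y
    using that unfolding lab_def by auto
  \<comment> \<open>The label factors through the colour.\<close>
  then have g: "lab x = lab (inv B (B x))" for x by (metis f_inv_into_f rangeI)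
  have fin: "finite C" by (simp add: s_eq)
  show ?thesis
  proof
    show "finite C" by fact
    show "x i \<le> M" if "x \<in> C" for x i using s_le_p that by auto
    show "x i \<le> Suc (y i)" if "x \<in> C" "y \<in> C" for x y i
      using base_le[OF \<open>y \<in> C\<close>, of i] le_Suc_base[OF \<open>x \<in> C\<close>, of i] by simp
    have "{..N} = (\<lambda>c. reduced N (lab (inv B c))) ` B ` C"
      unfolding full[symmetric] image_image comp_def using g by (intro image_cong) auto
    then have "card {..N} \<le> card (B ` C)"
      using fin by (metis card_image_le finite_imageI)
    then show "card (B ` C) \<ge> Suc N" by simp
  qed
qed

text \<open>
  The two nested infima over extended natural numbers are attained, because the order is
  well-founded; the covers can then be used directly.
\<close>

lemma nagata_dim_le_covers:
  fixes S :: "'a::metric_space set"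
  assumes "nagata_dim S \<le> enat n"
  shows "\<exists>c>0. \<forall>s>0. \<exists>\<B>. \<Union>\<B> = S \<and> (\<forall>B\<in>\<B>. diam_le B (c * s)) \<and>
    (\<forall>A\<subseteq>S. diam_le A s \<longrightarrow> finite {B\<in>\<B>. B \<inter> A \<noteq> {}} \<and> card {B\<in>\<B>. B \<inter> A \<noteq> {}} \<le> Suc n)"
proof -
  have Inf_le: "\<exists>k\<le>m. P k" if "Inf {enat k | k. P k} \<le> enat m" for P m
  proof -
    have "{enat k | k. P k} \<noteq> {}"
    proof
      assume "{enat k | k. P k} = {}"
      then show False using that by (simp only: Inf_enat_def) simp
    qed
    then have "Inf {enat k | k. P k} \<in> {enat k | k. P k}"
      by (meson ex_in_conv wellorder_InfI)
    then show ?thesis using that by (smt (verit) enat_ord_simps(1) mem_Collect_eq)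
  qed
  obtain m c where m: "m \<le> n" "c > 0" "\<forall>s>0. \<exists>\<B>.
       bounded_cover (c * s) S \<B> \<and> multiplicity_at s S \<B> \<le> enat (m + 1)"
    using Inf_le[OF assms[unfolded nagata_dim_def]] by blast
  show ?thesis
  proof (intro exI[of _ c] conjI allI impI)
    show "c > 0" by fact
    fix s :: real assume "s > 0"
    then obtain \<B> where \<B>: "bounded_cover (c * s) S \<B>" "multiplicity_at s S \<B> \<le> enat (m + 1)"
      using m(3) by blast
    obtain k where "k \<le> m + 1" and k: "\<forall>A\<subseteq>S. diam_le A s \<longrightarrow>
        finite {B\<in>\<B>. B \<inter> A \<noteq> {}} \<and> card {B\<in>\<B>. B \<inter> A \<noteq> {}} \<le> k"
      using Inf_le[OF \<B>(2)[unfolded multiplicity_at_def]] by blast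
    have "k \<le> Suc n" using \<open>k \<le> m + 1\<close> \<open>m \<le> n\<close> by simp
    then have "\<forall>A\<subseteq>S. diam_le A s \<longrightarrow>
        finite {B\<in>\<B>. B \<inter> A \<noteq> {}} \<and> card {B\<in>\<B>. B \<inter> A \<noteq> {}} \<le> Suc n"
      using k order_trans by blast
    then show "\<exists>\<B>. \<Union>\<B> = S \<and> (\<forall>B\<in>\<B>. diam_le B (c * s)) \<and>
       (\<forall>A\<subseteq>S. diam_le A s \<longrightarrow> finite {B\<in>\<B>. B \<inter> A \<noteq> {}} \<and> card {B\<in>\<B>. B \<inter> A \<noteq> {}} \<le> Suc n)"
      using \<B>(1) unfolding bounded_cover_def by (intro exI[of _ \<B>]) simp
  qed
qed

text \<open>
  This is the bound \<open>limsup \<^bsub>h \<rightarrow> 0\<^esub> dist (p + h w, S) / \<bar>h\<bar> \<le> e\<close>. A predicate replaces the upper limit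
  because that limit is infinite when \<open>p\<close> is not in the closure of \<open>S\<close>. The set \<open>S\<close> is flat at \<open>p\<close> in
  direction \<open>w\<close> if the bound holds with \<open>e = 0\<close>.
\<close>

definition deviation_le :: "'a::real_normed_vector set \<Rightarrow> 'a \<Rightarrow> 'a \<Rightarrow> real \<Rightarrow> bool" where
  "deviation_le S p w e \<longleftrightarrow> (\<forall>e'>e. \<forall>\<^sub>F h in at 0. infdist (p + h *\<^sub>R w) S \<le> e' * \<bar>h\<bar>)"

text \<open>
  If \<open>S\<close> is flat at \<open>p\<close> along an \<open>(n + 1)\<close>-dimensional space, then for small \<open>h\<close> all points of a fixed grid
  of mesh \<open>h\<close> in that space lie within \<open>h\<close> of \<open>S\<close>. A cover of \<open>S\<close> by sets of diameter at most \<open>c s\<close>, with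
  \<open>s\<close> a fixed multiple of \<open>h\<close>, then colours the grid. If the grid has enough points per side, no
  member of the cover reaches from one face to the opposite one, so some grid cell meets \<open>n + 2\<close> of its
  members. The cell has diameter at most \<open>s\<close>, which the multiplicity bound forbids.
\<close>

lemma nagata_dim_flat_bound:
  fixes S :: "'a::real_inner set" and v :: "nat \<Rightarrow> 'a"
  assumes nagata: "nagata_dim S \<le> enat n" and "S \<noteq> {}"
    and orthonormal: "\<And>i j. i \<le> n \<Longrightarrow> j \<le> n \<Longrightarrow> v i \<bullet> v j = (if i = j then 1 else 0)"
    and flat: "\<And>x :: nat \<Rightarrow> real. deviation_le S p (\<Sum>i\<le>n. x i *\<^sub>R v i) 0"
  shows False
proof -
  obtain c where "c > 0" and cover: "\<forall>s>0. \<exists>\<B>. \<Union>\<B> = S \<and> (\<forall>B\<in>\<B>. diam_le B (c * s)) \<and>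
    (\<forall>A\<subseteq>S. diam_le A s \<longrightarrow> finite {B\<in>\<B>. B \<inter> A \<noteq> {}} \<and> card {B\<in>\<B>. B \<inter> A \<noteq> {}} \<le> Suc n)"
    using nagata_dim_le_covers[OF nagata] by (elim exE conjE) (rule that)
  define N where "N = Suc n"
  \<comment> \<open>The side length \<open>M h\<close> must exceed \<open>c s + 2 h\<close> with \<open>s = h (N + 2)\<close>, where \<open>2 h\<close> is the error of moving two points into \<open>S\<close>.\<close>
  obtain M :: nat where M: "c * (real N + 2) + 2 < real M" using reals_Archimedean2 by blast
  have "0 \<le> c * (real N + 2)" using \<open>c > 0\<close> by simp
  then have "0 < M" using M by (cases "M = 0") auto
  define dir where "dir x = (\<Sum>i\<le>n. real (x i) *\<^sub>R v i)" for x :: "nat \<Rightarrow> nat"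
  define G where "G = dir ` {x. \<forall>i. x i \<le> M}"
  have "G \<subseteq> dir ` ((\<lambda>x i. if i \<le> n then x i else 0) ` ({..n} \<rightarrow>\<^sub>E {..M}))"
  proof
    fix w assume "w \<in> G"
    then obtain x where x: "\<forall>i. x i \<le> M" "w = dir x" by (auto simp: G_def)
    let ?y = "\<lambda>i. if i \<le> n then restrict x {..n} i else 0"
    have "w = dir ?y" unfolding x dir_def by (intro sum.cong) auto
    moreover have "restrict x {..n} \<in> {..n} \<rightarrow>\<^sub>E {..M}" using x by auto
    ultimately show "w \<in> dir ` ((\<lambda>x i. if i \<le> n then x i else 0) ` ({..n} \<rightarrow>\<^sub>E {..M}))"
      by blast
  qed
  then have "finite G" by (rule finite_subset) (intro finite_imageI finite_PiE, auto)
  have "\<forall>\<^sub>F h in at_right 0. infdist (p + h *\<^sub>R w) S \<le> 1/2 * \<bar>h\<bar>" if w: "w \<in> G" for w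
  proof -
    obtain x where "w = dir x" using w by (auto simp: G_def)
    then have "deviation_le S p w 0" using flat[of "\<lambda>i. real (x i)"] by (simp add: dir_def)
    then have "\<forall>\<^sub>F h in at 0. infdist (p + h *\<^sub>R w) S \<le> 1/2 * \<bar>h\<bar>"
      unfolding deviation_le_def by (meson half_gt_zero zero_less_one)
    then show ?thesis by (simp add: eventually_at_split)
  qed
  then have "\<forall>\<^sub>F h in at_right 0. \<forall>w\<in>G. infdist (p + h *\<^sub>R w) S \<le> 1/2 * \<bar>h\<bar>"
    using \<open>finite G\<close> by (simp add: eventually_ball_finite_distrib)
  moreover have "\<forall>\<^sub>F h in at_right (0::real). h > 0" by (simp add: eventually_at_right_less)
  ultimately have "\<forall>\<^sub>F h in at_right 0. h > 0 \<and> (\<forall>w\<in>G. infdist (p + h *\<^sub>R w) S \<le> 1/2 * \<bar>h\<bar>)"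
    using eventually_conj by blast
  then obtain h :: real where "h > 0" and near: "\<And>w. w \<in> G \<Longrightarrow> infdist (p + h *\<^sub>R w) S \<le> 1/2 * \<bar>h\<bar>"
    using eventually_happens'[OF trivial_limit_at_right_real] by blast
  have "\<exists>a\<in>S. dist (p + h *\<^sub>R w) a < h" if "w \<in> G" for w
  proof -
    have "infdist (p + h *\<^sub>R w) S < h" using near[OF that] \<open>h > 0\<close> by simp
    then have "(INF a\<in>S. dist (p + h *\<^sub>R w) a) < h"
      using \<open>S \<noteq> {}\<close> by (simp add: infdist_notempty)
    then show ?thesis
      using cInf_lessD[of "dist (p + h *\<^sub>R w) ` S" h] \<open>S \<noteq> {}\<close> by auto
  qed
  then obtain \<sigma> where \<sigma>: "\<And>w. w \<in> G \<Longrightarrow> \<sigma> w \<in> S" "\<And>w. w \<in> G \<Longrightarrow> dist (p + h *\<^sub>R w) (\<sigma> w) < h"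
    by metis
  define s where "s = h * (real N + 2)"
  have "s > 0" using \<open>h > 0\<close> by (simp add: s_def add_nonneg_pos)
  have "\<exists>\<B>. \<Union>\<B> = S \<and> (\<forall>B\<in>\<B>. diam_le B (c * s)) \<and>
    (\<forall>A\<subseteq>S. diam_le A s \<longrightarrow> finite {B\<in>\<B>. B \<inter> A \<noteq> {}} \<and> card {B\<in>\<B>. B \<inter> A \<noteq> {}} \<le> Suc n)"
    using \<open>s > 0\<close> by (rule cover[rule_format])
  then obtain \<B> where \<B>: "\<Union>\<B> = S" "\<forall>B\<in>\<B>. diam_le B (c * s)" and
    mult: "\<forall>A\<subseteq>S. diam_le A s \<longrightarrow>
      finite {B\<in>\<B>. B \<inter> A \<noteq> {}} \<and> card {B\<in>\<B>. B \<inter> A \<noteq> {}} \<le> Suc n"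
    by (elim exE conjE) (rule that)
  have "\<forall>w\<in>G. \<exists>B\<in>\<B>. \<sigma> w \<in> B" using \<B>(1) \<sigma>(1) by blast
  then obtain b where b: "\<And>w. w \<in> G \<Longrightarrow> b w \<in> \<B> \<and> \<sigma> w \<in> b w" by metis
  have shift: "\<bar>dist (\<sigma> w) (\<sigma> w') - h * norm (w - w')\<bar> < 2 * h" if "w \<in> G" "w' \<in> G" for w w'
  proof -
    have "dist (p + h *\<^sub>R w) (p + h *\<^sub>R w') = h * norm (w - w')"
      using \<open>h > 0\<close> by (simp add: dist_norm flip: scaleR_diff_right)
    then show ?thesis using \<sigma>(2)[OF that(1)] \<sigma>(2)[OF that(2)]
      by (smt (verit) dist_commute dist_triangle)
  qed
  have diff: "dir x - dir y = (\<Sum>i\<le>n. (real (x i) - real (y i)) *\<^sub>R v i)" for x y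
    by (simp add: dir_def sum_subtractf scaleR_left_diff_distrib)
  have norm_v: "norm (v i) = 1" if "i \<le> n" for i
    using orthonormal[OF that that] by (simp add: norm_eq_1)
  have opposite: "b (dir x) \<noteq> b (dir y)"
    if x: "\<forall>i. x i \<le> M" and y: "\<forall>i. y i \<le> M" and j: "j < N" "x j = 0" "y j = M" for x y j
  proof
    assume eq: "b (dir x) = b (dir y)"
    have G: "dir x \<in> G" "dir y \<in> G" using x y by (auto simp: G_def)
    have "(dir y - dir x) \<bullet> v j = (\<Sum>i\<le>n. (real (y i) - real (x i)) * (v i \<bullet> v j))"
      by (simp add: diff inner_sum_left)
    also have "\<dots> = (\<Sum>i\<le>n. if i = j then real (y i) - real (x i) else 0)"
      using j by (intro sum.cong) (auto simp: orthonormal N_def)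
    also have "\<dots> = M" using j by (simp add: N_def)
    finally have "M \<le> norm (dir y - dir x)"
      using norm_cauchy_schwarz[of "dir y - dir x" "v j"] norm_v[of j] j by (simp add: N_def)
    then have "h * M \<le> h * norm (dir y - dir x)" using \<open>h > 0\<close> by simp
    then have "h * M - 2 * h < dist (\<sigma> (dir y)) (\<sigma> (dir x))"
      using shift[OF G(2,1)] by simp
    also have "\<dots> \<le> c * s"
    proof -
      have "bounded (b (dir x))" "diameter (b (dir x)) \<le> c * s"
        using b[OF G(1)] \<B>(2) by (auto simp: diam_le_def)
      then show ?thesis
        using b[OF G(1)] b[OF G(2)] eq
          diameter_bounded_bound[of "b (dir x)" "\<sigma> (dir y)" "\<sigma> (dir x)"] by simp
    qed
    finally have "h * M < h * (c * (real N + 2) + 2)" by (simp add: s_def algebra_simps)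
    then show False using M \<open>h > 0\<close> by simp
  qed
  obtain C where C: "finite C" "\<And>x i. x \<in> C \<Longrightarrow> x i \<le> M"
    "\<And>x y i. x \<in> C \<Longrightarrow> y \<in> C \<Longrightarrow> x i \<le> Suc (y i)" "card ((\<lambda>x. b (dir x)) ` C) \<ge> Suc N"
    using discrete_lebesgue_covering[OF \<open>0 < M\<close>, of N "\<lambda>x. b (dir x)"] opposite by blast
  have CG: "dir x \<in> G" if "x \<in> C" for x using C(2)[OF that] by (auto simp: G_def)
  define A where "A = (\<lambda>x. \<sigma> (dir x)) ` C"
  have "C \<noteq> {}" using C(4) by auto
  have "A \<subseteq> S" using CG \<sigma>(1) by (auto simp: A_def)
  have close: "dist (\<sigma> (dir x)) (\<sigma> (dir y)) \<le> s" if xy: "x \<in> C" "y \<in> C" for x y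
  proof -
    have "norm (dir x - dir y) \<le> (\<Sum>i\<le>n. norm ((real (x i) - real (y i)) *\<^sub>R v i))"
      unfolding diff by (rule norm_sum)
    also have "\<dots> \<le> (\<Sum>i\<le>n. 1)"
    proof (intro sum_mono)
      fix i assume "i \<in> {..n}"
      then show "norm ((real (x i) - real (y i)) *\<^sub>R v i) \<le> 1"
        using C(3)[OF xy, of i] C(3)[OF xy(2,1), of i] by (simp add: norm_v)
    qed
    finally have "h * norm (dir x - dir y) \<le> h * N" using \<open>h > 0\<close> by (simp add: N_def)
    then show ?thesis using shift[OF CG CG, OF xy] by (simp add: s_def algebra_simps)
  qed
  have "diam_le A s"
    unfolding diam_le_def
  proof
    show "bounded A" using C(1) by (simp add: A_def finite_imp_bounded)
    show "diameter A \<le> s"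
      using \<open>C \<noteq> {}\<close> close by (intro diameter_le) (auto simp: A_def dist_norm)
  qed
  then have meet: "finite {B\<in>\<B>. B \<inter> A \<noteq> {}}" "card {B\<in>\<B>. B \<inter> A \<noteq> {}} \<le> Suc n"
    using mult \<open>A \<subseteq> S\<close> by auto
  have "(\<lambda>x. b (dir x)) ` C \<subseteq> {B\<in>\<B>. B \<inter> A \<noteq> {}}"
    using b CG by (auto simp: A_def)
  from order_trans[OF card_mono[OF meet(1) this] meet(2)]
  have "card ((\<lambda>x. b (dir x)) ` C) \<le> Suc n" .
  then show False using C(4) by (simp add: N_def)
qed

section \<open>Null sets of parameters of a curve\<close>

lemma open_real_intervals:
  fixes U :: "real set"
  assumes "open U" and "U \<in> lmeasurable"
  shows "\<exists>c :: nat \<Rightarrow> real set.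
    (\<forall>n. open (c n) \<and> connected (c n) \<and> c n \<in> lmeasurable) \<and> (\<Union>n. c n) = U \<and>
    (\<forall>n C. connected C \<longrightarrow> C \<subseteq> U \<longrightarrow> C \<inter> c n \<noteq> {} \<longrightarrow> C \<subseteq> c n) \<and>
    (\<forall>n. \<forall>x\<in>c n. \<forall>y\<in>c n. \<bar>x - y\<bar> \<le> measure lebesgue (c n)) \<and>
    (\<lambda>n. measure lebesgue (c n)) sums measure lebesgue U"
proof -
  have op: "open I" if "I \<in> components U" for I
    using open_components[OF \<open>open U\<close> that] .
  have "pairwise disjnt (components U)"
    using components_nonoverlap by (auto simp: pairwise_def disjnt_def)
  then have cnt: "countable (components U)"
    using op by (intro countable_disjoint_open_subsets)
  define f where "f = to_nat_on (components U)"
  have inj: "inj_on f (components U)" unfolding f_def using cnt by (rule inj_on_to_nat_on)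
  define c where "c n = \<Union>{I \<in> components U. f I = n}" for n
  have c_cases: "c n = {} \<or> (c n \<in> components U \<and> f (c n) = n)" for n
  proof (cases "\<exists>I\<in>components U. f I = n")
    case True
    then obtain I where I: "I \<in> components U" "f I = n" by blast
    then have "{J \<in> components U. f J = n} = {I}" using inj by (auto simp: inj_on_def)
    then show ?thesis using I by (simp add: c_def)
  qed (auto simp: c_def)
  have opc: "open (c n)" for n using c_cases[of n] op by auto
  have conc: "connected (c n)" for n
    using c_cases[of n] in_components_connected by auto
  have Un: "(\<Union>n. c n) = U"
  proof -
    have "(\<Union>n. c n) = \<Union>(components U)" unfolding c_def by blast
    then show ?thesis using Union_components[of U] by (simp only:)
  qed
  have disj: "disjoint_family c"
    unfolding disjoint_family_on_def
  proof (intro ballI impI)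
    fix m n :: nat assume "m \<noteq> n"
    then show "c m \<inter> c n = {}"
      using c_cases[of m] c_cases[of n] components_nonoverlap[of "c m" U "c n"] by auto
  qed
  have meas: "c n \<in> lmeasurable" for n
  proof (rule fmeasurableI2[OF assms(2)])
    show "c n \<subseteq> U" using Un by auto
    show "c n \<in> sets lebesgue" using opc[of n] by (simp add: borel_open)
  qed
  show ?thesis
  proof (intro exI[of _ c] conjI allI impI ballI)
    show "C \<subseteq> c n" if "connected C" "C \<subseteq> U" "C \<inter> c n \<noteq> {}" for n C
      using c_cases[of n] components_maximal[of "c n" U C] that by auto
    show "\<bar>x - y\<bar> \<le> measure lebesgue (c n)" if "x \<in> c n" "y \<in> c n" for n x y
    proof -
      have *: "\<bar>x - y\<bar> \<le> measure lebesgue (c n)" if "x \<in> c n" "y \<in> c n" "x \<le> y" for x y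
      proof -
        have "{x..y} \<subseteq> c n" using connected_contains_Icc[OF conc[of n] that(1,2)] .
        then have "measure lebesgue {x..y} \<le> measure lebesgue (c n)"
          using meas[of n] by (intro measure_mono_fmeasurable) auto
        then show ?thesis using that(3) by simp
      qed
      show ?thesis using *[OF that] *[OF that(2,1)] by linarith
    qed
    have "(\<lambda>n. measure lebesgue (c n)) sums measure lebesgue (\<Union>n. c n)"
    proof (rule measure_UNION[OF _ disj])
      show "range c \<subseteq> sets lebesgue" using meas by auto
      show "emeasure lebesgue (\<Union>n. c n) \<noteq> \<infinity>"
        using assms(2) Un by (auto simp: fmeasurable_def)
    qed
    then show "(\<lambda>n. measure lebesgue (c n)) sums measure lebesgue U" by (simp add: Un)
  qed (use opc conc meas Un in auto)
qed

text \<open>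
  At almost every point of \<open>A\<close> the gaps of \<open>A\<close> are small compared with their distance to the point. A gap
  that violates this at \<open>t\<close>, seen from distance \<open>\<bar>h\<bar>\<close>, contains an interval of length comparable to \<open>\<bar>h\<bar>\<close>, so
  \<open>t\<close> lies in the enlargement of that gap by a factor depending only on \<open>e\<close>. The lengths of the gaps are
  summable, so by the Borel-Cantelli lemma almost every \<open>t\<close> lies in finitely many of these enlargements,
  and finitely many gaps come arbitrarily close only to their own end points.
\<close>

lemma negligible_porous:
  fixes A :: "real set"
  assumes "bounded A"
  shows "negligible {t\<in>A. \<not> (\<forall>e>0. \<forall>\<^sub>F h in at 0. infdist (t + h) A \<le> e * \<bar>h\<bar>)}"
proof -
  obtain K where K: "\<And>t. t \<in> A \<Longrightarrow> \<bar>t\<bar> \<le> K"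
    using assms unfolding bounded_iff by auto
  define U where "U = {- K - 1<..<K + 1} - closure A"
  have "open U" unfolding U_def by (intro open_Diff) auto
  have "U \<in> lmeasurable"
    using \<open>open U\<close> by (intro lmeasurable_open) (auto intro: bounded_subset[of "{- K - 1<..<K + 1}"] simp: U_def)
  obtain c :: "nat \<Rightarrow> real set" where
    c: "\<forall>n. open (c n) \<and> connected (c n) \<and> c n \<in> lmeasurable" "(\<Union>n. c n) = U"
    and maximal: "\<forall>n C. connected C \<longrightarrow> C \<subseteq> U \<longrightarrow> C \<inter> c n \<noteq> {} \<longrightarrow> C \<subseteq> c n"
    and width: "\<forall>n. \<forall>x\<in>c n. \<forall>y\<in>c n. \<bar>x - y\<bar> \<le> measure lebesgue (c n)"
    and sums: "(\<lambda>n. measure lebesgue (c n)) sums measure lebesgue U"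
    using open_real_intervals[OF \<open>open U\<close> \<open>U \<in> lmeasurable\<close>] by (elim exE conjE) (rule that)
  define l where "l n = measure lebesgue (c n)" for n
  have l: "l n \<ge> 0" for n by (simp add: l_def)
  have main: "negligible {t\<in>A. \<not> (\<forall>\<^sub>F h in at 0. infdist (t + h) A \<le> e * \<bar>h\<bar>)}"
    (is "negligible ?N") if "e > 0" for e
  proof -
    define z where "z n = (SOME x. x \<in> c n)" for n
    have z: "z n \<in> c n" if "c n \<noteq> {}" for n
      unfolding z_def using that some_in_eq by blast
    define J where "J n = cball (z n) ((1 + 1 / e) * l n)" for n
    have "AE t in lebesgue. \<forall>\<^sub>F n in sequentially. t \<in> space lebesgue - J n"
    proof (rule borel_cantelli_AE1)
      show "J n \<in> sets lebesgue" for n by (simp add: J_def)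
      show "emeasure lebesgue (J n) < \<infinity>" for n
        unfolding J_def using emeasure_lborel_cball_finite by (simp add: top.not_eq_extremum)
      have "measure lebesgue (J n) = 2 * (1 + 1 / e) * l n" for n
        using \<open>e > 0\<close> l[of n] by (simp add: J_def cball_eq_atLeastAtMost)
      then show "summable (\<lambda>n. measure lebesgue (J n))"
        using sums by (auto intro!: summable_mult simp: l_def sums_iff)
    qed
    then obtain N where N: "negligible N"
      "\<And>t. t \<notin> N \<Longrightarrow> \<forall>\<^sub>F n in sequentially. t \<notin> J n"
      by (auto elim!: AE_E3 simp: negligible_iff_null_sets)
    have "?N \<subseteq> N \<union> (\<Union>n. frontier (c n))"
    proof (rule ccontr)
      assume "\<not> ?thesis"
      then obtain t where t: "t \<in> A" "t \<notin> N" "\<And>n. t \<notin> frontier (c n)"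
        and bad: "\<not> (\<forall>\<^sub>F h in at 0. infdist (t + h) A \<le> e * \<bar>h\<bar>)" by blast
      have "t \<notin> U" using \<open>t \<in> A\<close> closure_subset by (auto simp: U_def)
      obtain n0 where n0: "\<And>n. n \<ge> n0 \<Longrightarrow> t \<notin> J n"
        using N(2)[OF t(2)] by (auto simp: eventually_sequentially)
      have "t \<notin> closure (c n)" for n
        using t(3)[of n] \<open>t \<notin> U\<close> c by (auto simp: frontier_def interior_open)
      then have "\<forall>\<^sub>F h in at 0. t + h \<notin> closure (c n)" for n
      proof -
        assume *: "\<And>n. t \<notin> closure (c n)"
        have "((\<lambda>h. t + h) \<longlongrightarrow> t) (at 0)" by (auto intro!: tendsto_eq_intros)
        then show ?thesis
          using topological_tendstoD[of "\<lambda>h. t + h" t "at 0" "- closure (c n)"] *[of n] by auto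
      qed
      then have "\<forall>\<^sub>F h in at 0. \<forall>n\<in>{..<n0}. t + h \<notin> closure (c n)"
        by (simp add: eventually_ball_finite_distrib)
      moreover have "\<forall>\<^sub>F h in at (0::real). \<bar>h\<bar> < 1/2"
        by (auto simp: eventually_at intro!: exI[of _ "1/2"])
      ultimately have "\<forall>\<^sub>F h in at 0. infdist (t + h) A \<le> e * \<bar>h\<bar>"
      proof eventually_elim
        case (elim h)
        show ?case
        proof (rule ccontr)
          assume far: "\<not> infdist (t + h) A \<le> e * \<bar>h\<bar>"
          define d where "d = infdist (t + h) A"
          have d: "e * \<bar>h\<bar> < d" using far by (simp add: d_def)
          then have "d > 0" using \<open>e > 0\<close> by (smt (verit) mult_nonneg_nonneg abs_ge_zero)
          have "d \<le> \<bar>h\<bar>" using infdist_le[OF t(1), of "t + h"] by (simp add: d_def dist_real_def)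
          have ball: "ball (t + h) d \<subseteq> U"
          proof
            fix y assume y: "y \<in> ball (t + h) d"
            then have "y \<notin> closure A"
            proof (rule contrapos_pn)
              assume "y \<in> closure A"
              then have "infdist y A = 0" using \<open>t \<in> A\<close> in_closure_iff_infdist_zero by auto
              then have "d \<le> dist (t + h) y"
                using infdist_triangle[of "t + h" A y] by (simp add: d_def)
              then show "y \<notin> ball (t + h) d" by simp
            qed
            moreover have "\<bar>y\<bar> < K + 1"
              using y K[OF t(1)] \<open>d \<le> \<bar>h\<bar>\<close> elim(2) by (auto simp: dist_real_def)
            ultimately show "y \<in> U" by (auto simp: U_def)
          qed
          then have "t + h \<in> U" using \<open>d > 0\<close> by auto
          then obtain n where n: "t + h \<in> c n" using c(2) by auto
          have sub: "ball (t + h) d \<subseteq> c n"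
          proof (rule maximal[rule_format, OF _ ball])
            show "connected (ball (t + h) d)" by (simp add: convex_connected)
            have "t + h \<in> ball (t + h) d \<inter> c n" using n \<open>d > 0\<close> by simp
            then show "ball (t + h) d \<inter> c n \<noteq> {}" by blast
          qed
          have "n \<ge> n0" using elim(1) n closure_subset by (meson lessThan_iff not_le subsetD)
          have "d \<le> l n"
          proof -
            have "t + h + d/2 \<in> c n" "t + h - d/2 \<in> c n"
              using sub \<open>d > 0\<close> by (auto simp: dist_real_def)
            then have "\<bar>(t + h + d/2) - (t + h - d/2)\<bar> \<le> measure lebesgue (c n)"
              using width by blast
            then show ?thesis using \<open>d > 0\<close> by (simp add: l_def)
          qed
          then have "\<bar>h\<bar> \<le> l n / e" using d \<open>e > 0\<close> by (simp add: field_simps)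
          moreover have "\<bar>z n - (t + h)\<bar> \<le> l n"
            unfolding l_def using n by (intro width[rule_format] z) auto
          ultimately have "t \<in> J n"
            by (simp add: J_def dist_real_def algebra_simps)
          then show False using n0 \<open>n \<ge> n0\<close> by blast
        qed
      qed
      then show False using bad by blast
    qed
    moreover have "negligible (\<Union>n. frontier (c n))"
    proof (rule negligible_Union_nat)
      show "negligible (frontier (c n))" for n
        using c(1) connected_convex_1[of "c n"] negligible_convex_frontier by simp
    qed
    ultimately show ?thesis using N(1) by (meson negligible_Un negligible_subset)
  qed
  have "{t\<in>A. \<not> (\<forall>e>0. \<forall>\<^sub>F h in at 0. infdist (t + h) A \<le> e * \<bar>h\<bar>)}
    \<subseteq> (\<Union>k::nat. {t\<in>A. \<not> (\<forall>\<^sub>F h in at 0. infdist (t + h) A \<le> 1 / Suc k * \<bar>h\<bar>)})"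
  proof clarsimp
    fix t e assume "t \<in> A" "e > 0" and bad: "\<not> (\<forall>\<^sub>F h in at 0. infdist (t + h) A \<le> e * \<bar>h\<bar>)"
    obtain k where k: "1 / Suc k < e" using nat_approx_posE[OF \<open>e > 0\<close>] by blast
    have "\<not> (\<forall>\<^sub>F h in at 0. infdist (t + h) A \<le> 1 / Suc k * \<bar>h\<bar>)"
    proof
      assume "\<forall>\<^sub>F h in at 0. infdist (t + h) A \<le> 1 / Suc k * \<bar>h\<bar>"
      then have "\<forall>\<^sub>F h in at 0. infdist (t + h) A \<le> e * \<bar>h\<bar>"
        by eventually_elim (meson abs_ge_zero k less_eq_real_def mult_right_mono order_trans)
      then show False using bad by blast
    qed
    then show "\<exists>k. \<not> (\<forall>\<^sub>F h in at 0. infdist (t + h) A \<le> \<bar>h\<bar> / (1 + real k))"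
      by (intro exI[of _ k]) (simp add: add.commute)
  qed
  then show ?thesis
    by (rule negligible_subset[rotated]) (intro negligible_Union_nat main, simp)
qed

text \<open>
  The components of an open set of small measure that contains \<open>N\<close> are short intervals, and a
  1-Lipschitz map does not increase their diameters.
\<close>

lemma hausdorff1_lipschitz_image_negligible:
  fixes \<gamma> :: "real \<Rightarrow> 'a::metric_space"
  assumes "negligible N" and lip: "1-lipschitz_on N \<gamma>"
  shows "hausdorff1 (\<gamma> ` N) = 0"
proof -
  have bound: "hausdorff1_premeasure \<delta> (\<gamma> ` N) \<le> ennreal e" if "\<delta> > 0" "e > 0" for \<delta> e :: real
  proof -
    obtain U where U: "open U" "N \<subseteq> U" "U \<in> lmeasurable" "measure lebesgue U < min \<delta> e"
    proof -
      have null: "N \<in> null_sets lebesgue" using assms(1) by (simp add: negligible_iff_null_sets)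
      obtain T where T: "open T" "N \<subseteq> T" "(T - N) \<in> lmeasurable"
          "emeasure lebesgue (T - N) < ennreal (min \<delta> e)"
        using sets_lebesgue_outer_open[of N "min \<delta> e"] null \<open>\<delta> > 0\<close> \<open>e > 0\<close> by (auto simp: null_sets_def)
      have "T = (T - N) \<union> N" using T(2) by auto
      then have "emeasure lebesgue T = emeasure lebesgue (T - N)"
        using T(3) null by (metis emeasure_Un_null_set fmeasurableD)
      then have em: "emeasure lebesgue T < ennreal (min \<delta> e)" using T(4) by simp
      then have "T \<in> lmeasurable"
        using T(1) by (intro fmeasurableI) (auto simp: borel_open intro: less_trans ennreal_less_top)
      moreover have "measure lebesgue T < min \<delta> e"
        using em \<open>\<delta> > 0\<close> \<open>e > 0\<close> by (simp add: emeasure_eq_measure2 \<open>T \<in> lmeasurable\<close> ennreal_less_iff)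
      ultimately show ?thesis using that T by blast
    qed
    obtain c :: "nat \<Rightarrow> real set" where
      c: "\<forall>n. open (c n) \<and> connected (c n) \<and> c n \<in> lmeasurable" "(\<Union>n. c n) = U"
      and width: "\<forall>n. \<forall>x\<in>c n. \<forall>y\<in>c n. \<bar>x - y\<bar> \<le> measure lebesgue (c n)"
      and sums: "(\<lambda>n. measure lebesgue (c n)) sums measure lebesgue U"
      using open_real_intervals[OF U(1,3)] by (elim exE conjE) (rule that)
    define V where "V n = \<gamma> ` (c n \<inter> N)" for n
    have dist: "dist x y \<le> measure lebesgue (c n)" if xy: "x \<in> V n" "y \<in> V n" for x y n
    proof -
      obtain s t where "s \<in> c n \<inter> N" "t \<in> c n \<inter> N" "x = \<gamma> s" "y = \<gamma> t"
        using xy by (auto simp: V_def)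
      then show ?thesis
        using lipschitz_onD[OF lip, of s t] width by (fastforce simp: dist_real_def)
    qed
    have bdd: "bounded (V n)" for n
      using dist unfolding bounded_two_points by blast
    have diam: "diameter (V n) \<le> measure lebesgue (c n)" for n
      unfolding diameter_def using dist by (auto intro!: cSUP_least)
    have le: "measure lebesgue (c n) \<le> measure lebesgue U" for n
      using c(1,2) U(3) by (intro measure_mono_fmeasurable) auto
    have "hausdorff1_premeasure \<delta> (\<gamma> ` N) \<le> (\<Sum>n. ennreal (diameter (V n)))"
      unfolding hausdorff1_premeasure_def
    proof (rule INF_lower, safe)
      show "\<gamma> x \<in> (\<Union>n. V n)" if "x \<in> N" for x using that U(2) unfolding V_def c(2)[symmetric] by blast
      show "diam_le (V n) \<delta>" for n
        unfolding diam_le_def using bdd[of n] diam[of n] le[of n] U(4) by auto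
    qed
    also have "\<dots> \<le> (\<Sum>n. ennreal (measure lebesgue (c n)))"
      using diam by (intro suminf_le ennreal_leI) auto
    also have "\<dots> = ennreal (measure lebesgue U)"
      unfolding sums_unique[OF sums] by (rule suminf_ennreal2[OF measure_nonneg sums_summable[OF sums]])
    also have "\<dots> \<le> ennreal e" using U(4) by (intro ennreal_leI) auto
    finally show ?thesis .
  qed
  have "hausdorff1_premeasure \<delta> (\<gamma> ` N) \<le> 0" if "\<delta> > 0" for \<delta>
  proof (rule ennreal_le_epsilon)
    show "hausdorff1_premeasure \<delta> (\<gamma> ` N) \<le> 0 + ennreal e" if "e > 0" for e
      using bound[OF \<open>\<delta> > 0\<close> that] by simp
  qed
  then have "hausdorff1 (\<gamma> ` N) \<le> 0"
    unfolding hausdorff1_def by (intro SUP_least) simp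
  then show ?thesis by simp
qed

section \<open>Hilbert spaces without separability\<close>

lemma parallelogram_midpoint:
  fixes x y z :: "'a::real_inner"
  shows "(dist y z)\<^sup>2 = 2 * (dist x y)\<^sup>2 + 2 * (dist x z)\<^sup>2 - 4 * (dist x (midpoint y z))\<^sup>2"
proof -
  have m: "x - midpoint y z = (1/2) *\<^sub>R ((x - y) + (x - z))"
    by (simp add: midpoint_def algebra_simps flip: scaleR_add_left)
  show ?thesis
    unfolding dist_norm power2_norm_eq_inner m
    by (simp add: inner_simps inner_commute algebra_simps)
qed

text \<open>
  A substitute for weak compactness of balls. Points \<open>y m\<close> of \<open>K m\<close> that are almost closest to \<open>x\<close> have
  midpoints in \<open>K m\<close>, so the parallelogram law makes them a Cauchy sequence. With a constant
  sequence this is the projection theorem; with a decreasing one it shows that being close to every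
  \<open>K m\<close> can be tested without exhibiting a common point.
\<close>

lemma decreasing_convex_near_point:
  fixes K :: "nat \<Rightarrow> 'a::{real_inner, banach} set"
  assumes convex: "\<And>m. convex (K m)" and dec: "\<And>m n. m \<le> n \<Longrightarrow> K n \<subseteq> K m"
    and near: "\<And>m e. e > r \<Longrightarrow> \<exists>y\<in>K m. dist x y < e"
  shows "\<exists>y. (\<forall>m. y \<in> closure (K m)) \<and> dist x y \<le> r"
proof -
  have ne: "K m \<noteq> {}" for m using near[of r "m"] near[of "r + 1" m] by auto
  define d where "d m = infdist x (K m)" for m
  have d_le: "d m \<le> dist x y" if "y \<in> K m" for m y
    unfolding d_def using that by (rule infdist_le)
  have d_r: "d m \<le> r" for m
  proof (rule dense_ge)
    fix e assume "r < e"
    then show "d m \<le> e" using near[of e m] d_le[of _ m] by force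
  qed
  have "incseq d"
    unfolding d_def by (intro incseq_SucI infdist_mono dec ne) auto
  then obtain D where D: "d \<longlonglongrightarrow> D" "\<And>m. d m \<le> D"
    using incseq_convergent[of d r] d_r by blast
  have "D \<le> r" using D(1) d_r by (intro LIMSEQ_le_const2) auto
  have "\<exists>y\<in>K m. dist x y < D + 1 / Suc m" for m
  proof -
    have "d m < D + 1 / Suc m" using D(2)[of m] by (smt (verit) divide_pos_pos of_nat_0_less_iff zero_less_Suc)
    then have "(INF y\<in>K m. dist x y) < D + 1 / Suc m" using ne[of m] by (simp add: d_def infdist_notempty)
    then show ?thesis using cInf_lessD[of "dist x ` K m"] ne[of m] by auto
  qed
  then obtain y where y: "\<And>m. y m \<in> K m" "\<And>m. dist x (y m) < D + 1 / Suc m" by metis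
  \<comment> \<open>The bound from the parallelogram law for the squared distance of \<open>y m\<close> to all later terms.\<close>
  define g where "g m = 4 * (D + 1 / Suc m)\<^sup>2 - 4 * (d m)\<^sup>2" for m
  have "(\<lambda>m. 1 / real (Suc m)) \<longlonglongrightarrow> 0"
    using LIMSEQ_inverse_real_of_nat by (simp add: inverse_eq_divide)
  then have "g \<longlonglongrightarrow> 4 * (D + 0)\<^sup>2 - 4 * D\<^sup>2"
    unfolding g_def by (intro tendsto_intros D(1))
  then have g0: "g \<longlonglongrightarrow> 0" by simp
  have d0: "0 \<le> d m" for m by (simp add: d_def infdist_nonneg)
  have sq: "(dist (y m) (y n))\<^sup>2 \<le> g m" if "m \<le> n" for m n
  proof -
    have "midpoint (y m) (y n) \<in> K m"
      using y(1)[of m] y(1)[of n] dec[OF that] closed_segment_subset[OF _ _ convex[of m], of "y m" "y n"]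
      by (auto simp: subset_iff)
    then have "(d m)\<^sup>2 \<le> (dist x (midpoint (y m) (y n)))\<^sup>2"
      using d_le d0 by (intro power_mono) auto
    moreover have "(dist x (y m))\<^sup>2 \<le> (D + 1 / Suc m)\<^sup>2"
      using y(2)[of m] by (intro power_mono) auto
    moreover have "(dist x (y n))\<^sup>2 \<le> (D + 1 / Suc m)\<^sup>2"
    proof (intro power_mono)
      have "1 / real (Suc n) \<le> 1 / Suc m" using that by (simp add: frac_le)
      then show "dist x (y n) \<le> D + 1 / Suc m" using y(2)[of n] by linarith
    qed simp
    ultimately show ?thesis
      using parallelogram_midpoint[of "y m" "y n" x] by (simp add: g_def)
  qed
  have "Cauchy y"
    unfolding Cauchy_altdef2
  proof (intro allI impI)
    fix e :: real assume "e > 0"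
    then obtain m where "g m < e\<^sup>2"
      using order_tendstoD(2)[OF g0, of "e\<^sup>2"] by (auto simp: eventually_sequentially)
    then have "dist (y n) (y m) < e" if "n \<ge> m" for n
      using le_less_trans[OF sq[OF that]] power2_less_imp_less[of "dist (y m) (y n)" e] \<open>e > 0\<close>
      by (simp add: dist_commute)
    then show "\<exists>N. \<forall>n\<ge>N. dist (y n) (y N) < e" by blast
  qed
  then obtain z where z: "y \<longlonglongrightarrow> z" using Cauchy_convergent_iff convergent_def by blast
  have "z \<in> closure (K m)" for m
  proof (rule Lim_in_closed_set[OF closed_closure _ _ z])
    show "\<forall>\<^sub>F n in sequentially. y n \<in> closure (K m)"
      unfolding eventually_sequentially
      using y(1) dec[of m] closure_subset[of "K m"] by (intro exI[of _ m]) blast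
  qed simp
  moreover have "dist x z \<le> D"
  proof (rule LIMSEQ_le)
    show "(\<lambda>m. dist x (y m)) \<longlonglongrightarrow> dist x z" by (intro tendsto_intros z)
    show "(\<lambda>m. D + 1 / real (Suc m)) \<longlonglongrightarrow> D"
      using tendsto_add[OF tendsto_const \<open>(\<lambda>m. 1 / real (Suc m)) \<longlonglongrightarrow> 0\<close>] by simp
    show "\<exists>N. \<forall>n\<ge>N. dist x (y n) \<le> D + 1 / real (Suc n)" using y(2) less_imp_le by blast
  qed
  ultimately show ?thesis using \<open>D \<le> r\<close> by (meson order_trans)
qed

lemma closed_subspace_orthogonal_vector:
  fixes Y :: "'a::{real_inner, banach} set"
  assumes "subspace Y" "closed Y" "x \<notin> Y"
  shows "\<exists>u. u \<noteq> 0 \<and> (\<forall>v\<in>Y. orthogonal u v)"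
proof -
  have "Y \<noteq> {}" using subspace_0[OF assms(1)] by auto
  have "\<exists>y. (\<forall>m::nat. y \<in> closure Y) \<and> dist x y \<le> infdist x Y"
  proof (rule decreasing_convex_near_point)
    show "convex Y" by (rule subspace_imp_convex[OF assms(1)])
    show "\<exists>y\<in>Y. dist x y < e" if "e > infdist x Y" for e
      using that \<open>Y \<noteq> {}\<close> cInf_lessD[of "dist x ` Y"] by (auto simp: infdist_notempty)
  qed auto
  then obtain y where y: "y \<in> Y" "dist x y \<le> infdist x Y" using \<open>closed Y\<close> by auto
  have "orthogonal (x - y) v" if "v \<in> Y" for v
  proof (cases "v = 0")
    case False
    define t where "t = (x - y) \<bullet> v / (v \<bullet> v)"
    have "y + t *\<^sub>R v \<in> Y"
      using y that assms(1) by (intro subspace_add subspace_scale)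
    then have "dist x y \<le> dist x (y + t *\<^sub>R v)"
      using y(2) infdist_le order_trans by blast
    then have "(norm (x - y))\<^sup>2 \<le> (norm ((x - y) - t *\<^sub>R v))\<^sup>2"
      by (intro power_mono) (auto simp: dist_norm diff_diff_eq)
    also have "\<dots> = (norm (x - y))\<^sup>2 - 2 * t * ((x - y) \<bullet> v) + t\<^sup>2 * (v \<bullet> v)"
      unfolding power2_norm_eq_inner
      by (simp add: inner_diff inner_commute power2_eq_square algebra_simps)
    also have "\<dots> = (norm (x - y))\<^sup>2 - ((x - y) \<bullet> v)\<^sup>2 / (v \<bullet> v)"
      using False by (simp add: t_def power2_eq_square field_simps)
    finally have "((x - y) \<bullet> v)\<^sup>2 / (v \<bullet> v) \<le> 0" by simp
    moreover have "0 < v \<bullet> v" using False by (simp only: inner_gt_zero_iff not_False_eq_True)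
    ultimately have "((x - y) \<bullet> v)\<^sup>2 \<le> 0 * (v \<bullet> v)" by (simp only: pos_divide_le_eq)
    then show ?thesis by (simp add: orthogonal_def)
  qed (simp add: orthogonal_clauses)
  moreover have "x - y \<noteq> 0" using y(1) assms(3) by auto
  ultimately show ?thesis by blast
qed

lemma subspace_closure:
  fixes Y :: "'a::real_normed_vector set"
  assumes "subspace Y"
  shows "subspace (closure Y)"
proof (rule subspaceI)
  show "0 \<in> closure Y" using subspace_0[OF assms] closure_subset by auto
  show "x + y \<in> closure Y" if xy: "x \<in> closure Y" "y \<in> closure Y" for x y
  proof -
    obtain f g where fg: "\<And>n. f n \<in> Y" "f \<longlonglongrightarrow> x" "\<And>n. g n \<in> Y" "g \<longlonglongrightarrow> y"
      using xy unfolding closure_sequential by auto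
    have "(\<lambda>n. f n + g n) \<longlonglongrightarrow> x + y" by (intro tendsto_add fg)
    then show ?thesis unfolding closure_sequential
      using subspace_add[OF assms fg(1,3)] by (intro exI[of _ "\<lambda>n. f n + g n"]) auto
  qed
  show "c *\<^sub>R x \<in> closure Y" if x: "x \<in> closure Y" for c x
  proof -
    obtain f where f: "\<And>n. f n \<in> Y" "f \<longlonglongrightarrow> x" using x unfolding closure_sequential by auto
    have "(\<lambda>n. c *\<^sub>R f n) \<longlonglongrightarrow> c *\<^sub>R x" by (intro tendsto_scaleR tendsto_const f)
    then show ?thesis unfolding closure_sequential
      using subspace_scale[OF assms f(1)] by (intro exI[of _ "\<lambda>n. c *\<^sub>R f n"]) auto
  qed
qed

lemma orthonormal_basis_exists:
  "\<exists>B :: 'a::{real_inner, banach} set.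
     pairwise orthogonal B \<and> (\<forall>b\<in>B. norm b = 1) \<and> closure (span B) = UNIV"
proof -
  define \<A> where "\<A> = {B :: 'a set. pairwise orthogonal B \<and> (\<forall>b\<in>B. norm b = 1)}"
  have "\<exists>M\<in>\<A>. \<forall>X\<in>\<A>. M \<subseteq> X \<longrightarrow> X = M"
  proof (rule subset_Zorn_nonempty)
    show "\<A> \<noteq> {}" by (auto simp: \<A>_def intro!: exI[of _ "{}"])
    show "\<Union>\<C> \<in> \<A>" if "\<C> \<noteq> {}" and chain: "subset.chain \<A> \<C>" for \<C>
      unfolding \<A>_def
    proof (intro CollectI conjI pairwiseI ballI)
      fix b c assume bc: "b \<in> \<Union>\<C>" "c \<in> \<Union>\<C>" "b \<noteq> c"
      then obtain X' X'' where X': "X' \<in> \<C>" "b \<in> X'" and X'': "X'' \<in> \<C>" "c \<in> X''" by blast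
      then have "X' \<subseteq> X'' \<or> X'' \<subseteq> X'" using chain unfolding subset_chain_def by blast
      then obtain X where "X \<in> \<C>" "b \<in> X" "c \<in> X" using X' X'' by blast
      moreover have "X \<in> \<A>" using chain \<open>X \<in> \<C>\<close> by (auto simp: subset_chain_def)
      ultimately show "orthogonal b c" using bc(3) by (auto simp: \<A>_def pairwise_def)
    next
      fix b assume "b \<in> \<Union>\<C>"
      then show "norm b = 1" using chain by (auto simp: subset_chain_def \<A>_def)
    qed
  qed
  then obtain B where B: "B \<in> \<A>" and maximal: "\<And>X. X \<in> \<A> \<Longrightarrow> B \<subseteq> X \<Longrightarrow> X = B" by blast
  have "closure (span B) = UNIV"
  proof (rule ccontr)
    assume "closure (span B) \<noteq> UNIV"
    then obtain x where "x \<notin> closure (span B)" by auto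
    then obtain u where u: "u \<noteq> 0" "\<forall>v\<in>closure (span B). orthogonal u v"
      using closed_subspace_orthogonal_vector[of "closure (span B)" x] by (auto simp: subspace_closure)
    have ortho: "orthogonal u b" if "b \<in> B" for b
      using u(2) that by (meson closure_subset span_base subsetD)
    define w where "w = (1 / norm u) *\<^sub>R u"
    have "insert w B \<in> \<A>"
      using B ortho u(1) unfolding \<A>_def
      by (auto simp: pairwise_insert w_def orthogonal_clauses orthogonal_commute)
    then have "w \<in> B" using maximal[of "insert w B"] by auto
    then have "orthogonal u w" by (rule ortho)
    then show False using u(1) by (simp add: w_def orthogonal_def)
  qed
  then show ?thesis using B by (auto simp: \<A>_def)
qed

lemma finite_span_dense_sequence:
  fixes F :: "'a::real_normed_vector set"
  assumes "finite F"
  shows "\<exists>d :: nat \<Rightarrow> 'a. range d \<subseteq> span F \<and> span F \<subseteq> closure (range d)"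
proof -
  define Q where "Q = (\<lambda>c. \<Sum>b\<in>F. c b *\<^sub>R b) ` (F \<rightarrow>\<^sub>E \<rat>)"
  have "countable Q"
    unfolding Q_def by (intro countable_image countable_PiE assms countable_rat)
  have "(\<Sum>b\<in>F. restrict (\<lambda>_. 0) F b *\<^sub>R b) \<in> Q" unfolding Q_def by (intro imageI) auto
  then have "Q \<noteq> {}" by auto
  have "Q \<subseteq> span F" unfolding Q_def by (intro image_subsetI span_sum span_scale span_base)
  have "span F \<subseteq> closure Q"
  proof
    fix u assume "u \<in> span F"
    then obtain a where a: "u = (\<Sum>b\<in>F. a b *\<^sub>R b)" using span_finite[OF assms] by auto
    show "u \<in> closure Q"
      unfolding closure_approachable
    proof (intro allI impI)
      fix e :: real assume "e > 0"
      define s where "s = (\<Sum>b\<in>F. norm b) + 1"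
      have "s > 0" unfolding s_def by (intro add_nonneg_pos sum_nonneg) auto
      have "\<forall>b. \<exists>c\<in>\<rat>. \<bar>c - a b\<bar> < e / s"
      proof
        fix b
        obtain c where "c \<in> \<rat>" "a b < c" "c < a b + e / s"
          using Rats_dense_in_real[of "a b" "a b + e / s"] \<open>e > 0\<close> \<open>s > 0\<close> by auto
        then show "\<exists>c\<in>\<rat>. \<bar>c - a b\<bar> < e / s" by (intro bexI[of _ c]) auto
      qed
      then obtain c where c: "\<And>b. c b \<in> \<rat>" "\<And>b. \<bar>c b - a b\<bar> < e / s" by metis
      have "(\<Sum>b\<in>F. restrict c F b *\<^sub>R b) \<in> Q" unfolding Q_def using c(1) by (intro imageI) auto
      moreover have "(\<Sum>b\<in>F. restrict c F b *\<^sub>R b) = (\<Sum>b\<in>F. c b *\<^sub>R b)" by simp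
      ultimately have inQ: "(\<Sum>b\<in>F. c b *\<^sub>R b) \<in> Q" by simp
      have "dist (\<Sum>b\<in>F. c b *\<^sub>R b) u = norm (\<Sum>b\<in>F. (c b - a b) *\<^sub>R b)"
        by (simp add: a dist_norm sum_subtractf scaleR_left_diff_distrib)
      also have "\<dots> \<le> (\<Sum>b\<in>F. e / s * norm b)"
      proof (intro sum_norm_le)
        show "norm ((c b - a b) *\<^sub>R b) \<le> e / s * norm b" for b
          unfolding norm_scaleR real_norm_def using c(2)[of b] by (intro mult_right_mono) auto
      qed
      also have "\<dots> = e / s * (s - 1)" by (simp add: s_def sum_distrib_left)
      also have "\<dots> < e" using \<open>e > 0\<close> \<open>s > 0\<close> by (simp add: field_simps)
      finally show "\<exists>y\<in>Q. dist y u < e" using inQ by blast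
    qed
  qed
  moreover have "range (from_nat_into Q) = Q"
    using \<open>countable Q\<close> \<open>Q \<noteq> {}\<close> by (rule range_from_nat_into[rotated])
  ultimately show ?thesis using \<open>Q \<subseteq> span F\<close> by (intro exI[of _ "from_nat_into Q"]) simp
qed

section \<open>Functions that are locally constant on countably many pieces\<close>

text \<open>
  In a nonseparable space, pairs and sums of Borel maps need not be Borel, and a Borel map need not be a
  limit of maps with countably many values. Functions that are locally constant on each of countably
  many Borel pieces avoid both problems: every set has a Borel preimage under such a function, and they
  are closed under pairing and under composition with arbitrary functions.
\<close>

definition sigma_locally_constant :: "('a::metric_space \<Rightarrow> 'b) \<Rightarrow> bool" where
  "sigma_locally_constant f \<longleftrightarrow> (\<exists>X :: nat \<Rightarrow> 'a set. (\<forall>k. X k \<in> sets borel) \<and> (\<Union>k. X k) = UNIV \<and>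
     (\<forall>k. \<forall>p\<in>X k. \<exists>d>0. \<forall>q\<in>X k. dist p q < d \<longrightarrow> f q = f p))"

lemma sigma_locally_constant_const: "sigma_locally_constant (\<lambda>p. c)"
  unfolding sigma_locally_constant_def
  by (intro exI[of _ "\<lambda>k. UNIV"]) (simp add: gt_ex)

lemma sigma_locally_constant_comp:
  assumes "sigma_locally_constant f"
  shows "sigma_locally_constant (\<lambda>p. g (f p))"
proof -
  obtain X where X: "\<forall>k :: nat. X k \<in> sets borel" "(\<Union>k. X k) = UNIV"
    "\<forall>k. \<forall>p\<in>X k. \<exists>d>0. \<forall>q\<in>X k. dist p q < d \<longrightarrow> f q = f p"
    using assms unfolding sigma_locally_constant_def by (elim exE conjE) (rule that)
  have "\<forall>k. \<forall>p\<in>X k. \<exists>d>0. \<forall>q\<in>X k. dist p q < d \<longrightarrow> g (f q) = g (f p)"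
  proof (intro allI ballI)
    fix k p assume "p \<in> X k"
    then obtain d where "d > 0" "\<forall>q\<in>X k. dist p q < d \<longrightarrow> f q = f p" using X(3) by meson
    then show "\<exists>d>0. \<forall>q\<in>X k. dist p q < d \<longrightarrow> g (f q) = g (f p)"
      by (intro exI[of _ d]) simp
  qed
  then show ?thesis using X(1,2) unfolding sigma_locally_constant_def by (intro exI[of _ X]) simp
qed

lemma sigma_locally_constant_select:
  assumes \<kappa>: "sigma_locally_constant \<kappa>" and f: "\<And>n :: nat. sigma_locally_constant (f n)"
  shows "sigma_locally_constant (\<lambda>p. f (\<kappa> p) p)"
proof -
  obtain X where X: "\<forall>k :: nat. X k \<in> sets borel" "(\<Union>k. X k) = UNIV"
    "\<forall>k. \<forall>p\<in>X k. \<exists>d>0. \<forall>q\<in>X k. dist p q < d \<longrightarrow> \<kappa> q = \<kappa> p"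
    using \<kappa> unfolding sigma_locally_constant_def by (elim exE conjE) (rule that)
  have "\<forall>n. \<exists>Y. (\<forall>k :: nat. Y k \<in> sets borel) \<and> (\<Union>k. Y k) = UNIV \<and>
    (\<forall>k. \<forall>p\<in>Y k. \<exists>d>0. \<forall>q\<in>Y k. dist p q < d \<longrightarrow> f n q = f n p)"
    using f unfolding sigma_locally_constant_def by (rule allI)
  from choice[OF this] obtain Y where "\<forall>n. (\<forall>k :: nat. Y n k \<in> sets borel) \<and> (\<Union>k. Y n k) = UNIV \<and>
    (\<forall>k. \<forall>p\<in>Y n k. \<exists>d>0. \<forall>q\<in>Y n k. dist p q < d \<longrightarrow> f n q = f n p)"
    by (elim exE) (rule that)
  then have Y: "\<forall>n k. Y n k \<in> sets borel" "\<forall>n. (\<Union>k. Y n k) = UNIV"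
    "\<forall>n k. \<forall>p\<in>Y n k. \<exists>d>0. \<forall>q\<in>Y n k. dist p q < d \<longrightarrow> f n q = f n p"
    by simp_all
  \<comment> \<open>On each piece, the level sets of \<open>\<kappa>\<close> are relatively open.\<close>
  have lev: "X k \<inter> {p. \<kappa> p = n} \<in> sets borel" for k n
  proof -
    have "\<forall>p\<in>X k. \<exists>d>0. \<forall>q\<in>X k. dist p q < d \<longrightarrow> \<kappa> q = \<kappa> p" using X(3) by blast
    then obtain d where d: "\<forall>p\<in>X k. d p > 0 \<and> (\<forall>q\<in>X k. dist p q < d p \<longrightarrow> \<kappa> q = \<kappa> p)"
      by (subst (asm) bchoice_iff) (elim exE, rule that)
    have "X k \<inter> {p. \<kappa> p = n} = X k \<inter> (\<Union>p\<in>X k \<inter> {p. \<kappa> p = n}. ball p (d p))"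
    proof (intro set_eqI iffI)
      fix q assume "q \<in> X k \<inter> (\<Union>p\<in>X k \<inter> {p. \<kappa> p = n}. ball p (d p))"
      then obtain p where "q \<in> X k" "p \<in> X k" "\<kappa> p = n" "dist p q < d p" by auto
      moreover from this have "\<kappa> q = \<kappa> p" using d by blast
      ultimately show "q \<in> X k \<inter> {p. \<kappa> p = n}" by simp
    next
      fix p assume p: "p \<in> X k \<inter> {p. \<kappa> p = n}"
      then have "p \<in> ball p (d p)" using d by simp
      then show "p \<in> X k \<inter> (\<Union>p\<in>X k \<inter> {p. \<kappa> p = n}. ball p (d p))" using p by blast
    qed
    moreover have "open (\<Union>p\<in>X k \<inter> {p. \<kappa> p = n}. ball p (d p))" by auto
    ultimately show ?thesis using X(1) by (metis borel_open sets.Int)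
  qed
  define Z where "Z m = (case prod_decode m of (k, m') \<Rightarrow> case prod_decode m' of (n, l) \<Rightarrow>
    (X k \<inter> {p. \<kappa> p = n}) \<inter> Y n l)" for m
  have "\<forall>m. Z m \<in> sets borel"
    unfolding Z_def using lev Y(1) by (auto split: prod.split)
  moreover have "(\<Union>m. Z m) = UNIV"
  proof (intro set_eqI iffI)
    fix p
    obtain k where "p \<in> X k" using X(2) by blast
    moreover obtain l where "p \<in> Y (\<kappa> p) l" using Y(2) by blast
    ultimately have "p \<in> Z (prod_encode (k, prod_encode (\<kappa> p, l)))" by (simp add: Z_def)
    then show "p \<in> (\<Union>m. Z m)" by blast
  qed simp
  moreover have "\<forall>m. \<forall>p\<in>Z m. \<exists>d>0. \<forall>q\<in>Z m. dist p q < d \<longrightarrow> f (\<kappa> q) q = f (\<kappa> p) p"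
  proof (intro allI ballI)
    fix m p assume p: "p \<in> Z m"
    obtain k m' n l where "prod_decode m = (k, m')" "prod_decode m' = (n, l)" by (metis prod.exhaust)
    then have m: "Z m = (X k \<inter> {p. \<kappa> p = n}) \<inter> Y n l" by (simp add: Z_def)
    obtain d where d: "d > 0" "\<forall>q\<in>Y n l. dist p q < d \<longrightarrow> f n q = f n p"
      using Y(3) p m by blast
    show "\<exists>d>0. \<forall>q\<in>Z m. dist p q < d \<longrightarrow> f (\<kappa> q) q = f (\<kappa> p) p"
    proof (intro exI[of _ d] conjI ballI impI)
      fix q assume "q \<in> Z m" "dist p q < d"
      then have "f n q = f n p" "\<kappa> q = n" using d(2) m by blast+
      moreover have "\<kappa> p = n" using p m by blast
      ultimately show "f (\<kappa> q) q = f (\<kappa> p) p" by (simp only:)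
    qed (rule d(1))
  qed
  ultimately show ?thesis unfolding sigma_locally_constant_def by (intro exI[of _ Z]) simp
qed

lemma sigma_locally_constant_pair:
  assumes f: "sigma_locally_constant f" and g: "sigma_locally_constant g"
  shows "sigma_locally_constant (\<lambda>p. (f p, g p))"
proof -
  obtain X where X: "\<forall>k :: nat. X k \<in> sets borel" "(\<Union>k. X k) = UNIV"
    "\<forall>k. \<forall>p\<in>X k. \<exists>d>0. \<forall>q\<in>X k. dist p q < d \<longrightarrow> f q = f p"
    using f unfolding sigma_locally_constant_def by (elim exE conjE) (rule that)
  obtain Y where Y: "\<forall>k :: nat. Y k \<in> sets borel" "(\<Union>k. Y k) = UNIV"
    "\<forall>k. \<forall>p\<in>Y k. \<exists>d>0. \<forall>q\<in>Y k. dist p q < d \<longrightarrow> g q = g p"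
    using g unfolding sigma_locally_constant_def by (elim exE conjE) (rule that)
  define Z where "Z m = (case prod_decode m of (k, l) \<Rightarrow> X k \<inter> Y l)" for m
  have "\<forall>m. Z m \<in> sets borel" unfolding Z_def using X(1) Y(1) by (auto split: prod.split)
  moreover have "(\<Union>m. Z m) = UNIV"
  proof (intro set_eqI iffI)
    fix p
    obtain k l where "p \<in> X k" "p \<in> Y l" using X(2) Y(2) by blast
    then have "p \<in> Z (prod_encode (k, l))" by (simp add: Z_def)
    then show "p \<in> (\<Union>m. Z m)" by blast
  qed simp
  moreover have "\<forall>m. \<forall>p\<in>Z m. \<exists>d>0. \<forall>q\<in>Z m. dist p q < d \<longrightarrow> (f q, g q) = (f p, g p)"
  proof (intro allI ballI)
    fix m p assume p: "p \<in> Z m"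
    obtain k l where "prod_decode m = (k, l)" by force
    then have m: "Z m = X k \<inter> Y l" by (simp add: Z_def)
    obtain d where d: "d > 0" "\<forall>q\<in>X k. dist p q < d \<longrightarrow> f q = f p" using X(3) p m by blast
    obtain e where e: "e > 0" "\<forall>q\<in>Y l. dist p q < e \<longrightarrow> g q = g p" using Y(3) p m by blast
    show "\<exists>d>0. \<forall>q\<in>Z m. dist p q < d \<longrightarrow> (f q, g q) = (f p, g p)"
      using d e unfolding m by (intro exI[of _ "min d e"]) simp
  qed
  ultimately show ?thesis unfolding sigma_locally_constant_def by (intro exI[of _ Z]) simp
qed

text \<open>
  On a piece where \<open>f\<close> is locally constant, a limit of points satisfying \<open>R (f q) q\<close> eventually sees a
  constant value of \<open>f\<close>, so the relation defines a relatively closed subset of the piece.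
\<close>

lemma sigma_locally_constant_closed:
  assumes f: "sigma_locally_constant f" and closed: "\<And>w. closed {p. R w p}"
  shows "{p. R (f p) p} \<in> sets borel"
proof -
  obtain X where X: "\<forall>k :: nat. X k \<in> sets borel" "(\<Union>k. X k) = UNIV"
    "\<forall>k. \<forall>p\<in>X k. \<exists>d>0. \<forall>q\<in>X k. dist p q < d \<longrightarrow> f q = f p"
    using f unfolding sigma_locally_constant_def by (elim exE conjE) (rule that)
  define C where "C k = {p\<in>X k. R (f p) p}" for k
  have "{p. R (f p) p} = (\<Union>k. X k \<inter> closure (C k))"
  proof (intro set_eqI iffI)
    fix p assume "p \<in> {p. R (f p) p}"
    moreover obtain k where "p \<in> X k" using X(2) by blast
    ultimately have "p \<in> X k \<inter> closure (C k)" using closure_subset[of "C k"] by (auto simp: C_def)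
    then show "p \<in> (\<Union>k. X k \<inter> closure (C k))" by blast
  next
    fix p assume "p \<in> (\<Union>k. X k \<inter> closure (C k))"
    then obtain k where p: "p \<in> X k" "p \<in> closure (C k)" by blast
    then obtain d where d: "d > 0" "\<forall>q\<in>X k. dist p q < d \<longrightarrow> f q = f p" using X(3) by blast
    have "p \<in> closure {q. R (f p) q}"
      unfolding closure_approachable
    proof (intro allI impI)
      fix e :: real assume "e > 0"
      then obtain q where q: "q \<in> C k" "dist q p < min d e"
        using p(2) \<open>d > 0\<close> unfolding closure_approachable by (metis min_less_iff_conj)
      then have "f q = f p" using d(2) by (auto simp: C_def dist_commute)
      then have "R (f p) q" using q(1) by (auto simp: C_def)
      then show "\<exists>q\<in>{q. R (f p) q}. dist q p < e" using q(2) by auto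
    qed
    then show "p \<in> {p. R (f p) p}" using closed[of "f p"] by simp
  qed
  then show ?thesis using X(1) by auto
qed

lemma sigma_locally_constant_vimage:
  assumes "sigma_locally_constant f"
  shows "{p. Q (f p)} \<in> sets borel"
  using sigma_locally_constant_closed[OF assms, of "\<lambda>w p. Q w"] by auto

lemma sigma_locally_constant_countable:
  fixes \<kappa> :: "'a::metric_space \<Rightarrow> nat"
  assumes "\<And>n. {p. \<kappa> p = n} \<in> sets borel"
  shows "sigma_locally_constant \<kappa>"
  unfolding sigma_locally_constant_def
proof (intro exI[of _ "\<lambda>n. {p. \<kappa> p = n}"] conjI allI ballI)
  show "{p. \<kappa> p = n} \<in> sets borel" for n by (rule assms)
  show "(\<Union>n. {p. \<kappa> p = n}) = UNIV" by blast
  show "\<exists>d>0. \<forall>q\<in>{p. \<kappa> p = n}. dist p q < d \<longrightarrow> \<kappa> q = \<kappa> p"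
    if "p \<in> {p. \<kappa> p = n}" for n p
    using that by (intro exI[of _ 1]) simp
qed

section \<open>The support of a point in an orthonormal basis\<close>

locale orthonormal_basis =
  fixes B :: "'a::{real_inner, banach} set"
  assumes ortho: "pairwise orthogonal B" and unit: "b \<in> B \<Longrightarrow> norm b = 1"
    and total: "closure (span B) = UNIV"
begin

definition large_coords :: "real \<Rightarrow> 'a \<Rightarrow> 'a set" where
  "large_coords r p = {b\<in>B. r \<le> \<bar>p \<bullet> b\<bar>}"

text \<open>
  The closed span of the basis vectors that are not orthogonal to \<open>p\<close>. It is always separable, all points
  of a curve together involve only countably many basis vectors, and at almost every parameter the
  derivative of a curve belongs to the space of its point.
\<close>

definition supp_space :: "'a \<Rightarrow> 'a set" where
  "supp_space p = {v. \<forall>b\<in>B. p \<bullet> b = 0 \<longrightarrow> v \<bullet> b = 0}"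

lemma inner_basis: "b \<in> B \<Longrightarrow> c \<in> B \<Longrightarrow> b \<bullet> c = (if b = c then 1 else 0)"
  using ortho unit by (auto simp: pairwise_def orthogonal_def norm_eq_1)

text \<open>
  The orthogonal projection onto the span of a finite set of basis vectors.
\<close>

definition trunc :: "'a set \<Rightarrow> 'a \<Rightarrow> 'a" where
  "trunc F v = (\<Sum>b\<in>F. (v \<bullet> b) *\<^sub>R b)"

lemma trunc_orthogonal:
  assumes "finite F" "F \<subseteq> B" "u \<in> span F"
  shows "(v - trunc F v) \<bullet> u = 0"
proof -
  have "orthogonal (v - trunc F v) c" if "c \<in> F" for c
  proof -
    have "trunc F v \<bullet> c = (\<Sum>b\<in>F. if b = c then v \<bullet> c else 0)"
      unfolding trunc_def inner_sum_left using assms(2) that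
      by (intro sum.cong) (auto simp: inner_basis subset_iff)
    then show ?thesis using assms(1) that by (simp add: orthogonal_def inner_diff_left)
  qed
  then show ?thesis using orthogonal_to_span[OF assms(3)] by (simp add: orthogonal_def)
qed

lemma trunc_in_span: "trunc F v \<in> span F"
  unfolding trunc_def by (intro span_sum span_scale span_base)

lemma trunc_best:
  assumes "finite F" "F \<subseteq> B" "u \<in> span F"
  shows "(norm (v - u))\<^sup>2 = (norm (v - trunc F v))\<^sup>2 + (norm (trunc F v - u))\<^sup>2"
proof -
  have "trunc F v - u \<in> span F" using trunc_in_span assms(3) by (rule span_diff)
  then have "(v - trunc F v) \<bullet> (trunc F v - u) = 0" by (rule trunc_orthogonal[OF assms(1,2)])
  moreover have "v - u = (v - trunc F v) + (trunc F v - u)" by simp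
  ultimately show ?thesis using norm_add_Pythagorean[of "v - trunc F v" "trunc F v - u"]
    by (simp add: orthogonal_def)
qed

lemma bessel:
  assumes "finite F" "F \<subseteq> B"
  shows "(\<Sum>b\<in>F. (v \<bullet> b)\<^sup>2) \<le> (norm v)\<^sup>2"
proof -
  have "v \<bullet> trunc F v = trunc F v \<bullet> trunc F v"
    using trunc_orthogonal[OF assms trunc_in_span, of v v] by (simp add: inner_diff_left)
  then have "(norm (trunc F v))\<^sup>2 = trunc F v \<bullet> v"
    by (simp only: power2_norm_eq_inner inner_commute[of "trunc F v" v])
  also have "\<dots> = (\<Sum>b\<in>F. (v \<bullet> b)\<^sup>2)"
    unfolding trunc_def inner_sum_left inner_scaleR_left power2_eq_square
    by (intro sum.cong refl) (simp add: inner_commute)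
  finally show ?thesis using trunc_best[OF assms span_0, of v] by simp
qed

lemma finite_large_coords:
  assumes "r > 0"
  shows "finite (large_coords r p)"
proof (rule ccontr)
  assume inf: "infinite (large_coords r p)"
  obtain N :: nat where N: "(norm p)\<^sup>2 / r\<^sup>2 < real N" using reals_Archimedean2 by blast
  obtain F where F: "finite F" "card F = N" "F \<subseteq> large_coords r p"
    using infinite_arbitrarily_large[OF inf] by blast
  have "r\<^sup>2 * real N = (\<Sum>b\<in>F. r\<^sup>2)" using F(2) by simp
  also have "\<dots> \<le> (\<Sum>b\<in>F. (p \<bullet> b)\<^sup>2)"
  proof (intro sum_mono)
    fix b assume "b \<in> F"
    then have "r \<le> \<bar>p \<bullet> b\<bar>" using F(3) by (auto simp: large_coords_def)
    then show "r\<^sup>2 \<le> (p \<bullet> b)\<^sup>2" using assms by (metis abs_le_square_iff abs_of_pos)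
  qed
  also have "\<dots> \<le> (norm p)\<^sup>2"
    using F(3) by (intro bessel F(1)) (auto simp: large_coords_def)
  finally show False using N assms by (simp add: field_simps)
qed

text \<open>
  Truncating \<open>v\<close> to finitely many basis vectors is the best approximation from their span, and only
  coordinates in which \<open>v\<close>, hence \<open>p\<close>, does not vanish survive in it.
\<close>

lemma supp_space_approx:
  assumes "v \<in> supp_space p" "e > 0"
  obtains F u where "finite F" "F \<subseteq> {b\<in>B. p \<bullet> b \<noteq> 0}" "u \<in> span F" "dist v u < e"
proof -
  obtain u where u: "u \<in> span B" "dist u v < e"
    using total assms(2) closure_approachable[of v "span B"] by auto
  obtain F where F: "finite F" "F \<subseteq> B" "u \<in> span F"
    using u(1) unfolding span_explicit by (auto intro!: span_sum span_scale span_base)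
  define F' where "F' = {b\<in>F. v \<bullet> b \<noteq> 0}"
  have "trunc F v = trunc F' v"
    unfolding trunc_def F'_def using F(1) by (intro sum.mono_neutral_right) auto
  moreover have "norm (v - trunc F v) \<le> norm (v - u)"
    using trunc_best[OF F, of v] by (simp add: norm_le_square power2_norm_eq_inner flip: power2_norm_eq_inner)
  ultimately have "dist v (trunc F' v) < e" using u(2) by (simp add: dist_norm norm_minus_commute)
  moreover have "F' \<subseteq> {b\<in>B. p \<bullet> b \<noteq> 0}"
    using assms(1) F(2) by (auto simp: F'_def supp_space_def)
  ultimately show ?thesis using that[of F' "trunc F' v"] F(1) trunc_in_span by (simp add: F'_def)
qed

lemma supp_space_subspace: "subspace (supp_space p)"
  unfolding subspace_def supp_space_def by (auto simp: inner_simps)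

lemma supp_space_closed: "closed (supp_space p)"
proof -
  have "supp_space p = (\<Inter>b\<in>{b\<in>B. p \<bullet> b = 0}. {v. v \<bullet> b = 0})"
    by (auto simp: supp_space_def)
  moreover have "closed {v. v \<bullet> b = 0}" for b :: 'a
    by (intro closed_Collect_eq continuous_intros)
  ultimately show ?thesis by auto
qed

text \<open>
  Only finitely many coordinates exceed \<open>r / 2\<close>, so those below \<open>r\<close> stay below it by some margin
  \<open>1 / Suc m\<close>. On the closed set of points with a given margin, a coordinate cannot cross the
  threshold \<open>r\<close> within a ball of that radius.
\<close>

lemma sigma_locally_constant_large_coords:
  assumes "r > 0"
  shows "sigma_locally_constant (large_coords r)"
proof -
  define X where "X m = {p. \<forall>b\<in>B. r \<le> \<bar>p \<bullet> b\<bar> \<or> \<bar>p \<bullet> b\<bar> \<le> r - 1 / Suc m}" for m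
  have "closed (X m)" for m
  proof -
    have "X m = (\<Inter>b\<in>B. {p. r \<le> \<bar>p \<bullet> b\<bar>} \<union> {p. \<bar>p \<bullet> b\<bar> \<le> r - 1 / Suc m})"
      by (auto simp: X_def)
    also have "closed \<dots>"
      by (intro closed_INT ballI closed_Un closed_Collect_le continuous_intros)
    finally show ?thesis .
  qed
  then have X: "X m \<in> sets borel" for m by (rule borel_closed)
  have cover: "(\<Union>m. X m) = UNIV"
  proof (intro set_eqI iffI)
    fix p
    define G where "G = {b \<in> large_coords (r/2) p. \<bar>p \<bullet> b\<bar> < r}"
    have "finite G" using finite_large_coords[of "r/2" p] assms by (simp add: G_def)
    have "\<forall>b\<in>G. \<forall>\<^sub>F m in sequentially. \<bar>p \<bullet> b\<bar> < r - 1 / Suc m"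
    proof
      fix b assume "b \<in> G"
      have "(\<lambda>m. r - 1 / real (Suc m)) \<longlonglongrightarrow> r - 0"
        using LIMSEQ_inverse_real_of_nat by (intro tendsto_intros) (simp add: inverse_eq_divide)
      then show "\<forall>\<^sub>F m in sequentially. \<bar>p \<bullet> b\<bar> < r - 1 / Suc m"
        using \<open>b \<in> G\<close> order_tendstoD(1)[of _ r sequentially "\<bar>p \<bullet> b\<bar>"] by (auto simp: G_def)
    qed
    then have "\<forall>\<^sub>F m in sequentially. \<forall>b\<in>G. \<bar>p \<bullet> b\<bar> < r - 1 / Suc m"
      using \<open>finite G\<close> by (simp add: eventually_ball_finite_distrib)
    moreover have "\<forall>\<^sub>F m in sequentially. 1 / real (Suc m) < r / 2"
      using order_tendstoD(2)[OF LIMSEQ_inverse_real_of_nat, of "r/2"] assms by (simp add: inverse_eq_divide)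
    ultimately have "\<forall>\<^sub>F m in sequentially. p \<in> X m"
    proof eventually_elim
      case (elim m)
      show ?case unfolding X_def
      proof (intro CollectI ballI disjCI)
        fix b assume b: "b \<in> B" "\<not> \<bar>p \<bullet> b\<bar> \<le> r - 1 / Suc m"
        show "r \<le> \<bar>p \<bullet> b\<bar>"
        proof (rule ccontr)
          assume "\<not> r \<le> \<bar>p \<bullet> b\<bar>"
          then have "b \<in> G" using b elim(2) by (auto simp: G_def large_coords_def)
          then show False using elim(1) b(2) by force
        qed
      qed
    qed
    then show "p \<in> (\<Union>m. X m)" by (auto simp: eventually_sequentially)
  qed simp
  have "\<exists>d>0. \<forall>q\<in>X m. dist p q < d \<longrightarrow> large_coords r q = large_coords r p"
    if p: "p \<in> X m" for m p
  proof (intro exI[of _ "1 / Suc m"] conjI ballI impI)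
    fix q assume q: "q \<in> X m" "dist p q < 1 / Suc m"
    have "\<bar>\<bar>p \<bullet> b\<bar> - \<bar>q \<bullet> b\<bar>\<bar> < 1 / Suc m" if "b \<in> B" for b
    proof -
      have "\<bar>(p - q) \<bullet> b\<bar> \<le> norm (p - q) * norm b" by (rule Cauchy_Schwarz_ineq2)
      then have "\<bar>p \<bullet> b - q \<bullet> b\<bar> < 1 / Suc m"
        using q(2) unit[OF that] by (simp add: dist_norm inner_diff_left)
      then show ?thesis by linarith
    qed
    then show "large_coords r q = large_coords r p"
      using p q(1) unfolding X_def large_coords_def by fastforce
  qed simp
  then show ?thesis
    using X cover unfolding sigma_locally_constant_def by (intro exI[of _ X]) blast
qed

definition span_seq :: "'a set \<Rightarrow> nat \<Rightarrow> 'a" where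
  "span_seq F = (SOME d. range d \<subseteq> span F \<and> span F \<subseteq> closure (range d))"

text \<open>
  Arbitrary choices are harmless here: each term is a function of a finite set of large coordinates, and
  is therefore locally constant on countably many Borel pieces. The index codes a threshold and a
  position in the chosen dense sequence.
\<close>

definition supp_seq :: "nat \<Rightarrow> 'a \<Rightarrow> 'a" where
  "supp_seq a p = (case prod_decode a of (j, k) \<Rightarrow> span_seq (large_coords (1 / Suc j) p) k)"

lemma span_seq:
  assumes "finite F"
  shows "span_seq F k \<in> span F" "u \<in> span F \<Longrightarrow> e > 0 \<Longrightarrow> \<exists>k. dist u (span_seq F k) < e"
proof -
  have *: "range (span_seq F) \<subseteq> span F \<and> span F \<subseteq> closure (range (span_seq F))"
    unfolding span_seq_def using someI_ex[OF finite_span_dense_sequence[OF assms]] .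
  then show "span_seq F k \<in> span F" by auto
  show "\<exists>k. dist u (span_seq F k) < e" if "u \<in> span F" "e > 0"
  proof -
    have "u \<in> closure (range (span_seq F))" using * that(1) by blast
    then show ?thesis using that(2) by (auto simp: closure_approachable dist_commute)
  qed
qed

lemma supp_seq_in: "supp_seq a p \<in> supp_space p"
proof -
  obtain j k where a: "prod_decode a = (j, k)" by force
  have "supp_seq a p \<in> span (large_coords (1 / Suc j) p)"
    using span_seq(1)[OF finite_large_coords, of "1 / Suc j"] by (simp add: supp_seq_def a)
  also have "\<dots> \<subseteq> supp_space p"
  proof (rule span_minimal[OF _ supp_space_subspace])
    show "large_coords (1 / Suc j) p \<subseteq> supp_space p"
      by (auto simp: large_coords_def supp_space_def inner_basis)
  qed
  finally show ?thesis .
qed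

lemma supp_seq_dense:
  assumes "v \<in> supp_space p" "e > 0"
  shows "\<exists>a. dist v (supp_seq a p) < e"
proof -
  obtain F u where F: "finite F" "F \<subseteq> {b\<in>B. p \<bullet> b \<noteq> 0}" "u \<in> span F" "dist v u < e/2"
    using supp_space_approx[OF assms(1), of "e/2"] assms(2) by auto
  have "\<forall>b\<in>F. \<forall>\<^sub>F j in sequentially. b \<in> large_coords (1 / Suc j) p"
  proof
    fix b assume b: "b \<in> F"
    then have "\<forall>\<^sub>F j in sequentially. 1 / real (Suc j) < \<bar>p \<bullet> b\<bar>"
      using order_tendstoD(2)[OF LIMSEQ_inverse_real_of_nat, of "\<bar>p \<bullet> b\<bar>"] F(2) by (auto simp: inverse_eq_divide)
    then show "\<forall>\<^sub>F j in sequentially. b \<in> large_coords (1 / Suc j) p"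
      by eventually_elim (use b F(2) in \<open>auto simp: large_coords_def\<close>)
  qed
  then have "\<forall>\<^sub>F j in sequentially. \<forall>b\<in>F. b \<in> large_coords (1 / Suc j) p"
    using F(1) by (simp add: eventually_ball_finite_distrib)
  then obtain j where "F \<subseteq> large_coords (1 / Suc j) p" by (auto simp: eventually_sequentially)
  then have "u \<in> span (large_coords (1 / Suc j) p)" using F(3) span_mono by blast
  then obtain k where "dist u (span_seq (large_coords (1 / Suc j) p) k) < e/2"
    using span_seq(2)[OF finite_large_coords, of "1 / Suc j" u p "e/2"] assms(2) by auto
  then have "dist v (span_seq (large_coords (1 / Suc j) p) k) < e"
    using F(4) dist_triangle[of v "span_seq (large_coords (1 / Suc j) p) k" u] by linarith
  then have "dist v (supp_seq (prod_encode (j, k)) p) < e" by (simp add: supp_seq_def)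
  then show ?thesis by blast
qed

lemma sigma_locally_constant_supp_seq: "sigma_locally_constant (supp_seq a)"
proof -
  obtain j k where a: "prod_decode a = (j, k)" by force
  have "supp_seq a = (\<lambda>p. span_seq (large_coords (1 / Suc j) p) k)"
    by (rule ext) (simp add: supp_seq_def a)
  then show ?thesis
    using sigma_locally_constant_comp[OF sigma_locally_constant_large_coords, of "1 / Suc j" "\<lambda>F. span_seq F k"]
    by simp
qed

end

section \<open>Rates of deviation from lines\<close>

lemma deviation_le_mono: "deviation_le S p w e \<Longrightarrow> e \<le> e' \<Longrightarrow> deviation_le S p w e'"
  unfolding deviation_le_def by auto

lemma deviation_le_limit: "(\<And>e'. e' > e \<Longrightarrow> deviation_le S p w e') \<Longrightarrow> deviation_le S p w e"
  unfolding deviation_le_def by (metis dense)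

lemma deviation_le_perturb:
  assumes "deviation_le S p w e"
  shows "deviation_le S p w' (e + dist w w')"
  unfolding deviation_le_def
proof (intro allI impI)
  fix e' assume "e + dist w w' < e'"
  then have "\<forall>\<^sub>F h in at 0. infdist (p + h *\<^sub>R w) S \<le> (e' - dist w w') * \<bar>h\<bar>"
    using assms unfolding deviation_le_def by (metis less_diff_eq)
  then show "\<forall>\<^sub>F h in at 0. infdist (p + h *\<^sub>R w') S \<le> e' * \<bar>h\<bar>"
  proof eventually_elim
    case (elim h)
    have "infdist (p + h *\<^sub>R w') S \<le> infdist (p + h *\<^sub>R w) S + dist (p + h *\<^sub>R w') (p + h *\<^sub>R w)"
      by (rule infdist_triangle)
    also have "dist (p + h *\<^sub>R w') (p + h *\<^sub>R w) = \<bar>h\<bar> * dist w w'"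
      by (simp add: dist_norm norm_minus_commute flip: scaleR_diff_right)
    finally show ?case using elim by (simp add: algebra_simps)
  qed
qed

lemma deviation_le_scale:
  assumes "deviation_le S p w e" "c \<noteq> 0"
  shows "deviation_le S p (c *\<^sub>R w) (\<bar>c\<bar> * e)"
  unfolding deviation_le_def
proof (intro allI impI)
  fix e' assume "\<bar>c\<bar> * e < e'"
  then have "e < e' / \<bar>c\<bar>" using \<open>c \<noteq> 0\<close> by (simp add: field_simps)
  then have ev: "\<forall>\<^sub>F h in at 0. infdist (p + h *\<^sub>R w) S \<le> e' / \<bar>c\<bar> * \<bar>h\<bar>"
    using assms(1) unfolding deviation_le_def by blast
  have "filterlim (\<lambda>h. h * c) (at 0) (at 0)"
    using \<open>c \<noteq> 0\<close> by (auto simp: filterlim_at eventually_at_filter intro!: tendsto_eq_intros)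
  from eventually_compose_filterlim[OF ev this]
  show "\<forall>\<^sub>F h in at 0. infdist (p + h *\<^sub>R c *\<^sub>R w) S \<le> e' * \<bar>h\<bar>"
    by eventually_elim (use \<open>c \<noteq> 0\<close> in \<open>simp add: abs_mult\<close>)
qed

lemma deviation_le_zero: "p \<in> closure S \<Longrightarrow> deviation_le S p 0 0"
  using in_closure_iff_infdist_zero[of S p] unfolding deviation_le_def
  by (cases "S = {}") (auto intro!: always_eventually)

text \<open>
  The condition at a fixed scale, which is closed in \<open>p\<close> and thus makes the rates Borel.
\<close>

definition deviation_within :: "'a::real_normed_vector set \<Rightarrow> real \<Rightarrow> nat \<Rightarrow> 'a \<Rightarrow> 'a \<Rightarrow> bool" where
  "deviation_within S e m w p \<longleftrightarrow> (\<forall>h. h \<noteq> 0 \<longrightarrow> \<bar>h\<bar> < 1 / Suc m \<longrightarrow> infdist (p + h *\<^sub>R w) S \<le> e * \<bar>h\<bar>)"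

lemma closed_deviation_within: "closed {p. deviation_within S e m w p}"
proof -
  have "{p. deviation_within S e m w p} =
    (\<Inter>h\<in>{h. h \<noteq> 0 \<and> \<bar>h\<bar> < 1 / Suc m}. {p. infdist (p + h *\<^sub>R w) S \<le> e * \<bar>h\<bar>})"
    by (auto simp: deviation_within_def)
  also have "closed \<dots>" by (intro closed_INT ballI closed_Collect_le continuous_intros)
  finally show ?thesis .
qed

lemma eventually_deviation_within:
  "(\<forall>\<^sub>F h in at 0. infdist (p + h *\<^sub>R w) S \<le> e * \<bar>h\<bar>) \<longleftrightarrow> (\<exists>m. deviation_within S e m w p)"
proof
  assume "\<forall>\<^sub>F h in at 0. infdist (p + h *\<^sub>R w) S \<le> e * \<bar>h\<bar>"
  then obtain d where d: "d > 0" "\<forall>h. h \<noteq> 0 \<and> dist h 0 < d \<longrightarrow> infdist (p + h *\<^sub>R w) S \<le> e * \<bar>h\<bar>"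
    unfolding eventually_at by auto
  obtain m where "1 / Suc m < d" using nat_approx_posE[OF d(1)] by blast
  then show "\<exists>m. deviation_within S e m w p"
    using d(2) by (intro exI[of _ m]) (auto simp: deviation_within_def)
next
  assume "\<exists>m. deviation_within S e m w p"
  then obtain m where "deviation_within S e m w p" by blast
  then show "\<forall>\<^sub>F h in at 0. infdist (p + h *\<^sub>R w) S \<le> e * \<bar>h\<bar>"
    unfolding deviation_within_def eventually_at by (intro exI[of _ "1 / Suc m"]) auto
qed

lemma deviation_le_iff_within:
  "deviation_le S p w e \<longleftrightarrow> (\<forall>k. \<exists>m. deviation_within S (e + 1 / Suc k) m w p)"
proof
  assume "deviation_le S p w e"
  then show "\<forall>k. \<exists>m. deviation_within S (e + 1 / Suc k) m w p"
    unfolding deviation_le_def eventually_deviation_within by simp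
next
  assume *: "\<forall>k. \<exists>m. deviation_within S (e + 1 / Suc k) m w p"
  show "deviation_le S p w e"
    unfolding deviation_le_def
  proof (intro allI impI)
    fix e' assume "e' > e"
    then obtain k where k: "1 / Suc k < e' - e" using nat_approx_posE[of "e' - e"] by auto
    have "\<forall>\<^sub>F h in at 0. infdist (p + h *\<^sub>R w) S \<le> (e + 1 / Suc k) * \<bar>h\<bar>"
      using * eventually_deviation_within by blast
    then show "\<forall>\<^sub>F h in at 0. infdist (p + h *\<^sub>R w) S \<le> e' * \<bar>h\<bar>"
    proof eventually_elim
      case (elim h)
      have "(e + 1 / Suc k) * \<bar>h\<bar> \<le> e' * \<bar>h\<bar>" using k by (intro mult_right_mono) auto
      then show ?case using elim by linarith
    qed
  qed
qed

lemma deviation_le_borel: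
  assumes "sigma_locally_constant f"
  shows "{p. deviation_le S p (f p) e} \<in> sets borel"
proof -
  have "{p. deviation_le S p (f p) e} = (\<Inter>k. \<Union>m. {p. deviation_within S (e + 1 / Suc k) m (f p) p})"
    unfolding deviation_le_iff_within by blast
  also have "\<dots> \<in> sets borel"
    using sigma_locally_constant_closed[OF assms closed_deviation_within] by (intro sets.countable_INT' sets.countable_UN') auto
  finally show ?thesis .
qed

context orthonormal_basis
begin

section \<open>The tangent space of a set at a point\<close>

text \<open>
  Adding \<open>v\<close> to a direction raises the rate of deviation by at most \<open>\<eta>\<close>. For \<open>\<eta> = 0\<close> the vectors \<open>v\<close> form
  a group of periods of the rate, and homogeneity of the rate turns this group into a linear subspace.
  Positive \<open>\<eta>\<close> gives convex sets with nonempty interior in \<open>supp_space p\<close>, which a dense sequence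
  of that space meets.
\<close>

definition shift_le :: "'a set \<Rightarrow> 'a \<Rightarrow> real \<Rightarrow> 'a \<Rightarrow> bool" where
  "shift_le S p \<eta> v \<longleftrightarrow> v \<in> supp_space p \<and>
     (\<forall>w\<in>supp_space p. \<forall>e. deviation_le S p w e \<longrightarrow> deviation_le S p (w + v) (e + \<eta>))"

definition tangent_space :: "'a set \<Rightarrow> 'a \<Rightarrow> 'a set" where
  "tangent_space S p = {v. shift_le S p 0 v}"

lemma shift_le_mono: "shift_le S p \<eta> v \<Longrightarrow> \<eta> \<le> \<eta>' \<Longrightarrow> shift_le S p \<eta>' v"
  unfolding shift_le_def by (meson add_left_mono deviation_le_mono)

lemma shift_le_limit:
  assumes "\<And>\<eta>'. \<eta>' > \<eta> \<Longrightarrow> shift_le S p \<eta>' v"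
  shows "shift_le S p \<eta> v"
  unfolding shift_le_def
proof (intro conjI ballI allI impI)
  show "v \<in> supp_space p" using assms[of "\<eta> + 1"] by (simp add: shift_le_def)
  fix w e assume w: "w \<in> supp_space p" "deviation_le S p w e"
  show "deviation_le S p (w + v) (e + \<eta>)"
  proof (rule deviation_le_limit)
    fix e' assume "e + \<eta> < e'"
    then show "deviation_le S p (w + v) e'"
      using assms[of "e' - e"] w unfolding shift_le_def by fastforce
  qed
qed

lemma shift_le_add:
  assumes "shift_le S p \<eta> v" "shift_le S p \<eta>' v'"
  shows "shift_le S p (\<eta> + \<eta>') (v + v')"
  unfolding shift_le_def
proof (intro conjI ballI allI impI)
  show "v + v' \<in> supp_space p"
    using assms supp_space_subspace by (simp add: shift_le_def subspace_add)
  fix w e assume w: "w \<in> supp_space p" "deviation_le S p w e"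
  have "w + v \<in> supp_space p"
    using assms(1) w(1) supp_space_subspace by (simp add: shift_le_def subspace_add)
  moreover have "deviation_le S p (w + v) (e + \<eta>)" using assms(1) w by (simp add: shift_le_def)
  ultimately have "deviation_le S p (w + v + v') (e + \<eta> + \<eta>')"
    using assms(2) by (simp add: shift_le_def)
  then show "deviation_le S p (w + (v + v')) (e + (\<eta> + \<eta>'))" by (simp add: add.assoc)
qed

lemma shift_le_zero: "0 \<le> \<eta> \<Longrightarrow> shift_le S p \<eta> 0"
  unfolding shift_le_def using subspace_0[OF supp_space_subspace] by (auto elim!: deviation_le_mono)

lemma shift_le_scale:
  assumes "shift_le S p \<eta> v"
  shows "shift_le S p (\<bar>c\<bar> * \<eta>) (c *\<^sub>R v)"
proof (cases "c = 0")
  case False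
  show ?thesis
    unfolding shift_le_def
  proof (intro conjI ballI allI impI)
    show "c *\<^sub>R v \<in> supp_space p"
      using assms supp_space_subspace by (simp add: shift_le_def subspace_scale)
    fix w e assume w: "w \<in> supp_space p" "deviation_le S p w e"
    have "(1 / c) *\<^sub>R w \<in> supp_space p" using w(1) supp_space_subspace by (simp add: subspace_scale)
    moreover have "deviation_le S p ((1 / c) *\<^sub>R w) (\<bar>1 / c\<bar> * e)"
      using w(2) False by (intro deviation_le_scale) auto
    ultimately have "deviation_le S p ((1 / c) *\<^sub>R w + v) (\<bar>1 / c\<bar> * e + \<eta>)"
      using assms unfolding shift_le_def by blast
    then have "deviation_le S p (c *\<^sub>R ((1 / c) *\<^sub>R w + v)) (\<bar>c\<bar> * (\<bar>1 / c\<bar> * e + \<eta>))"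
      using False by (rule deviation_le_scale)
    moreover have "c *\<^sub>R ((1 / c) *\<^sub>R w + v) = w + c *\<^sub>R v" using False by (simp add: scaleR_add_right)
    moreover have "\<bar>c\<bar> * (\<bar>1 / c\<bar> * e + \<eta>) = e + \<bar>c\<bar> * \<eta>" using False by (simp add: field_simps)
    ultimately show "deviation_le S p (w + c *\<^sub>R v) (e + \<bar>c\<bar> * \<eta>)" by simp
  qed
qed (simp add: shift_le_zero)

lemma shift_le_perturb:
  assumes "shift_le S p \<eta> v" "v' \<in> supp_space p"
  shows "shift_le S p (\<eta> + dist v v') v'"
  unfolding shift_le_def
proof (intro conjI ballI allI impI)
  fix w e assume "w \<in> supp_space p" "deviation_le S p w e"
  then have "deviation_le S p (w + v) (e + \<eta>)" using assms(1) by (simp add: shift_le_def)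
  from deviation_le_perturb[OF this, of "w + v'"]
  show "deviation_le S p (w + v') (e + (\<eta> + dist v v'))" by (simp add: add.assoc)
qed (rule assms(2))

lemma tangent_space_supp: "tangent_space S p \<subseteq> supp_space p"
  by (auto simp: tangent_space_def shift_le_def)

lemma subspace_tangent_space: "subspace (tangent_space S p)"
  unfolding subspace_def tangent_space_def
  using shift_le_zero[of 0] shift_le_add[of S p 0 _ 0] shift_le_scale[of S p 0] by auto

text \<open>
  At points of the closure the direction \<open>0\<close> has rate \<open>0\<close>, and periods preserve the rate.
\<close>

lemma tangent_space_flat:
  assumes "p \<in> closure S" "v \<in> tangent_space S p"
  shows "deviation_le S p v 0"
proof -
  have "0 \<in> supp_space p" using supp_space_subspace by (rule subspace_0)
  then have "deviation_le S p (0 + v) (0 + 0)"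
    using assms(2) deviation_le_zero[OF assms(1)] unfolding tangent_space_def shift_le_def by blast
  then show ?thesis by simp
qed

text \<open>
  The rate is 1-Lipschitz in the direction, so a dense sequence of directions and rational rates suffice.
\<close>

lemma shift_le_iff_supp_seq:
  assumes "v \<in> supp_space p"
  shows "shift_le S p \<eta> v \<longleftrightarrow>
    (\<forall>b. \<forall>q\<in>\<rat>. deviation_le S p (supp_seq b p) q \<longrightarrow> deviation_le S p (supp_seq b p + v) (q + \<eta>))"
    (is "_ \<longleftrightarrow> ?R")
proof
  assume "shift_le S p \<eta> v"
  then show ?R unfolding shift_le_def using supp_seq_in by blast
next
  assume R: ?R
  show "shift_le S p \<eta> v"
    unfolding shift_le_def
  proof (intro conjI ballI allI impI)
    fix w e assume w: "w \<in> supp_space p" "deviation_le S p w e"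
    show "deviation_le S p (w + v) (e + \<eta>)"
    proof (rule deviation_le_limit)
      fix e' assume "e + \<eta> < e'"
      define \<rho> where "\<rho> = (e' - e - \<eta>) / 4"
      have "\<rho> > 0" using \<open>e + \<eta> < e'\<close> by (simp add: \<rho>_def)
      obtain b where b: "dist w (supp_seq b p) < \<rho>" using supp_seq_dense[OF w(1) \<open>\<rho> > 0\<close>] by blast
      obtain q where q: "q \<in> \<rat>" "e + \<rho> < q" "q < e + 2 * \<rho>"
        using Rats_dense_in_real[of "e + \<rho>" "e + 2 * \<rho>"] \<open>\<rho> > 0\<close> by auto
      have "deviation_le S p (supp_seq b p) (e + dist w (supp_seq b p))"
        using w(2) by (rule deviation_le_perturb)
      then have "deviation_le S p (supp_seq b p) q"
        using b q(2) by (elim deviation_le_mono) auto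
      then have "deviation_le S p (supp_seq b p + v) (q + \<eta>)" using R q(1) by blast
      from deviation_le_perturb[OF this, of "w + v"]
      have "deviation_le S p (w + v) (q + \<eta> + dist w (supp_seq b p))" by (simp add: dist_commute)
      moreover have "4 * \<rho> = e' - e - \<eta>" by (simp add: \<rho>_def)
      then have "q + \<eta> + dist w (supp_seq b p) \<le> e'" using b q(3) \<open>\<rho> > 0\<close> by linarith
      ultimately show "deviation_le S p (w + v) e'" by (rule deviation_le_mono)
    qed
  qed (rule assms)
qed

lemma shift_le_supp_seq_borel: "{p. shift_le S p \<eta> (supp_seq a p)} \<in> sets borel"
proof -
  have *: "{p. deviation_le S p (supp_seq b p) q \<longrightarrow>
      deviation_le S p (supp_seq b p + supp_seq a p) (q + \<eta>)} \<in> sets borel" for b q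
  proof -
    have "sigma_locally_constant (\<lambda>p. supp_seq b p + supp_seq a p)"
      using sigma_locally_constant_comp[OF sigma_locally_constant_pair[OF
        sigma_locally_constant_supp_seq[of b] sigma_locally_constant_supp_seq[of a]], of "\<lambda>(x, y). x + y"]
      by simp
    from deviation_le_borel[OF this, of S "q + \<eta>"]
      deviation_le_borel[OF sigma_locally_constant_supp_seq[of b], of S q]
    have "- {p. deviation_le S p (supp_seq b p) q} \<union>
      {p. deviation_le S p (supp_seq b p + supp_seq a p) (q + \<eta>)} \<in> sets borel"
      by (intro sets.Un) (simp_all add: borel_comp)
    then show ?thesis by (simp add: Collect_imp_eq)
  qed
  have "{p. shift_le S p \<eta> (supp_seq a p)} = (\<Inter>b. \<Inter>q\<in>\<rat>. {p. deviation_le S p (supp_seq b p) q \<longrightarrow>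
      deviation_le S p (supp_seq b p + supp_seq a p) (q + \<eta>)})"
    using shift_le_iff_supp_seq[OF supp_seq_in] by auto
  also have "\<dots> \<in> sets borel"
    using * countable_rat Rats_0 by (intro sets.countable_INT' ) (auto intro!: sets.countable_INT'' sets.countable_INT')
  finally show ?thesis .
qed

text \<open>
  The tangent space is the intersection of the convex sets \<open>shift_le S p (1 / Suc m)\<close>. Approximate
  solutions from the dense sequence yield a point in this intersection at the right distance
  although balls are not compact, by the nested convex sets argument. The right-hand side is a countable
  condition on \<open>p\<close>.
\<close>

lemma infdist_tangent_space_le_iff:
  "infdist x (tangent_space S p) \<le> r \<longleftrightarrow>
    (\<forall>m. \<exists>a. shift_le S p (1 / Suc m) (supp_seq a p) \<and> dist x (supp_seq a p) < r + 1 / Suc m)"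
    (is "_ \<longleftrightarrow> ?R")
proof
  have ne: "tangent_space S p \<noteq> {}" using subspace_0[OF subspace_tangent_space] by auto
  assume le: "infdist x (tangent_space S p) \<le> r"
  show ?R
  proof
    fix m
    have "infdist x (tangent_space S p) < r + 1 / Suc m"
      using le by (smt (verit) divide_pos_pos of_nat_0_less_iff zero_less_Suc)
    then obtain v where v: "v \<in> tangent_space S p" "dist x v < r + 1 / Suc m"
      using ne cInf_lessD[of "dist x ` tangent_space S p"] by (auto simp: infdist_notempty)
    define \<delta> where "\<delta> = min (1 / Suc m) (r + 1 / Suc m - dist x v)"
    have "\<delta> > 0" using v(2) by (simp add: \<delta>_def)
    then obtain a where a: "dist v (supp_seq a p) < \<delta>"
      using supp_seq_dense v(1) tangent_space_supp by blast
    have "shift_le S p (0 + dist v (supp_seq a p)) (supp_seq a p)"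
      using v(1) supp_seq_in by (intro shift_le_perturb) (auto simp: tangent_space_def)
    then have "shift_le S p (1 / Suc m) (supp_seq a p)"
      using a by (elim shift_le_mono) (simp add: \<delta>_def)
    moreover have "dist x (supp_seq a p) < r + 1 / Suc m"
      using a dist_triangle[of x "supp_seq a p" v] by (simp add: \<delta>_def)
    ultimately show "\<exists>a. shift_le S p (1 / Suc m) (supp_seq a p) \<and> dist x (supp_seq a p) < r + 1 / Suc m"
      by blast
  qed
next
  assume R: ?R
  define K where "K m = {v. shift_le S p (1 / Suc m) v}" for m
  have "\<exists>y. (\<forall>m. y \<in> closure (K m)) \<and> dist x y \<le> r"
  proof (rule decreasing_convex_near_point)
    show "convex (K m)" for m
      unfolding convex_def K_def
    proof clarsimp
      fix v v' :: 'a and s t :: real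
      assume *: "shift_le S p (1 / (1 + real m)) v" "shift_le S p (1 / (1 + real m)) v'" "0 \<le> s" "0 \<le> t" "s + t = 1"
      have "shift_le S p (\<bar>s\<bar> * (1 / (1 + real m)) + \<bar>t\<bar> * (1 / (1 + real m))) (s *\<^sub>R v + t *\<^sub>R v')"
        using * by (intro shift_le_add shift_le_scale)
      moreover have "\<bar>s\<bar> * (1 / (1 + real m)) + \<bar>t\<bar> * (1 / (1 + real m)) = 1 / (1 + real m)"
        using * by (simp flip: distrib_right add_divide_distrib)
      ultimately show "shift_le S p (1 / (1 + real m)) (s *\<^sub>R v + t *\<^sub>R v')" by simp
    qed
    show dec: "K n \<subseteq> K m" if "m \<le> n" for m n
      unfolding K_def using that by (auto elim!: shift_le_mono simp: frac_le)
    show "\<exists>y\<in>K m. dist x y < e" if "e > r" for m e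
    proof -
      have "0 < e - r" using that by simp
      then obtain k where k: "1 / Suc k < e - r" by (rule nat_approx_posE)
      define l where "l = max k m"
      have "1 / real (Suc l) \<le> 1 / Suc k" by (simp add: l_def frac_le)
      obtain a where a: "shift_le S p (1 / Suc l) (supp_seq a p)" "dist x (supp_seq a p) < r + 1 / Suc l"
        using R by blast
      have "supp_seq a p \<in> K l" using a(1) by (simp add: K_def)
      then have "supp_seq a p \<in> K m" using dec[of m l] by (auto simp: l_def)
      moreover have "dist x (supp_seq a p) < e" using a(2) k \<open>1 / real (Suc l) \<le> 1 / Suc k\<close> by linarith
      ultimately show ?thesis by blast
    qed
  qed
  then obtain y where y: "\<And>m. y \<in> closure (K m)" "dist x y \<le> r" by blast
  have "K 0 \<subseteq> supp_space p" by (auto simp: K_def shift_le_def)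
  then have "y \<in> supp_space p"
    using y(1)[of 0] supp_space_closed closure_minimal by blast
  have "shift_le S p 0 y"
  proof (rule shift_le_limit)
    fix \<eta> :: real assume "\<eta> > 0"
    then obtain m where m: "1 / Suc m < \<eta> / 2" using nat_approx_posE[of "\<eta> / 2"] by auto
    obtain v where v: "v \<in> K m" "dist v y < \<eta> / 2"
      using y(1)[of m] \<open>\<eta> > 0\<close> unfolding closure_approachable by (meson half_gt_zero)
    have "shift_le S p (1 / Suc m + dist v y) y"
      using v(1) \<open>y \<in> supp_space p\<close> by (intro shift_le_perturb) (simp_all add: K_def)
    then show "shift_le S p \<eta> y" using m v(2) by (elim shift_le_mono) simp
  qed
  then have "infdist x (tangent_space S p) \<le> dist x y"
    by (intro infdist_le) (simp add: tangent_space_def)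
  then show "infdist x (tangent_space S p) \<le> r" using y(2) by linarith
qed

lemma infdist_tangent_space_borel:
  assumes "sigma_locally_constant f"
  shows "(\<lambda>p. infdist (f p) (tangent_space S p)) \<in> borel_measurable borel"
  unfolding borel_measurable_iff_le
proof
  fix r
  have *: "{p. dist (f p) (supp_seq a p) < c} \<in> sets borel" for a c
    using sigma_locally_constant_vimage[OF sigma_locally_constant_pair[OF assms sigma_locally_constant_supp_seq[of a]],
        of "\<lambda>(x, y). dist x y < c"] by simp
  have "{p \<in> space borel. infdist (f p) (tangent_space S p) \<le> r} =
    (\<Inter>m. \<Union>a. {p. shift_le S p (1 / Suc m) (supp_seq a p)} \<inter> {p. dist (f p) (supp_seq a p) < r + 1 / Suc m})"
    using infdist_tangent_space_le_iff by auto
  also have "\<dots> \<in> sets borel"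
    using * shift_le_supp_seq_borel by (intro sets.countable_INT' sets.countable_UN') auto
  finally show "{p \<in> space borel. infdist (f p) (tangent_space S p) \<le> r} \<in> sets borel" .
qed

end

section \<open>Measurability of the tangent field\<close>

text \<open>
  Polarisation bounds the bilinear form on \<open>H\<close>. As the range lies in \<open>H\<close> and \<open>A\<close> is self-adjoint, applying
  \<open>A\<close> twice carries the bound from \<open>H\<close> to the whole space.
\<close>

lemma norm_le_quadratic_form:
  fixes A :: "'a::real_inner \<Rightarrow>\<^sub>L 'a"
  assumes selfadj: "\<And>x y. A x \<bullet> y = x \<bullet> A y" and H: "subspace H" "range A \<subseteq> H"
    and form: "\<And>x. x \<in> H \<Longrightarrow> \<bar>A x \<bullet> x\<bar> \<le> c * (norm x)\<^sup>2" and "0 \<le> c"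
  shows "norm A \<le> c"
proof -
  have on_H: "norm (A x) \<le> c * norm x" if x: "x \<in> H" for x
  proof (cases "A x = 0 \<or> x = 0")
    case False
    \<comment> \<open>The vector in the direction of \<open>A x\<close> is scaled to length \<open>norm x\<close>, which balances the two squares below.\<close>
    define y where "y = (norm x / norm (A x)) *\<^sub>R A x"
    have y: "y \<in> H" "norm y = norm x"
      using H False unfolding y_def by (auto intro!: subspace_scale)
    have "4 * (A x \<bullet> y) = A (x + y) \<bullet> (x + y) - A (x - y) \<bullet> (x - y)"
      using selfadj[of y x]
      by (simp add: blinfun.add_right blinfun.diff_right inner_simps inner_commute)
    also have "\<dots> \<le> c * (norm (x + y))\<^sup>2 + c * (norm (x - y))\<^sup>2"
      using form[of "x + y"] form[of "x - y"] x y(1) H(1) by (simp add: subspace_add subspace_diff)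
    also have "\<dots> = c * (2 * (norm x)\<^sup>2 + 2 * (norm y)\<^sup>2)"
      unfolding power2_norm_eq_inner by (simp add: inner_simps algebra_simps)
    finally have "A x \<bullet> y \<le> c * (norm x)\<^sup>2" by (simp add: y(2))
    moreover have "A x \<bullet> y = norm x * norm (A x)"
      using False by (simp add: y_def power2_eq_square flip: power2_norm_eq_inner)
    ultimately have "norm x * norm (A x) \<le> norm x * (c * norm x)"
      by (simp add: power2_eq_square mult_ac)
    then show ?thesis using False by simp
  qed (use \<open>0 \<le> c\<close> in auto)
  show ?thesis
  proof (rule norm_blinfun_bound[OF \<open>0 \<le> c\<close>])
    fix x
    show "norm (A x) \<le> c * norm x"
    proof (cases "A x = 0")
      case False
      have "norm (A x) * norm (A x) = x \<bullet> A (A x)"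
        using selfadj[of x "A x"] by (simp add: power2_norm_eq_inner flip: power2_eq_square)
      also have "\<dots> \<le> norm x * norm (A (A x))" by (rule norm_cauchy_schwarz)
      also have "\<dots> \<le> norm x * (c * norm (A x))"
        using on_H[of "A x"] H(2) by (intro mult_left_mono) auto
      finally have "norm (A x) * norm (A x) \<le> norm (A x) * (c * norm x)" by (simp add: mult_ac)
      then show ?thesis using False by simp
    qed (use \<open>0 \<le> c\<close> in auto)
  qed
qed

lemma subspaces_upto_orthonormal_span:
  assumes "finite U" "card U \<le> n" "\<And>u v. u \<in> U \<Longrightarrow> v \<in> U \<Longrightarrow> u \<bullet> v = (if u = v then 1 else 0)"
  shows "span U \<in> subspaces_upto n"
proof -
  have "independent U"
    using assms(3) by (intro pairwise_orthogonal_independent) (fastforce simp: pairwise_def orthogonal_def)+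
  then show ?thesis
    using assms(1,2) unfolding subspaces_upto_def subspaces_of_dim_def by blast
qed

lemma orthonormal_sets_bounded_span:
  fixes V :: "'a::real_inner set"
  assumes "subspace V"
    and bound: "\<And>U. finite U \<Longrightarrow> U \<subseteq> V \<Longrightarrow>
      (\<And>u v. u \<in> U \<Longrightarrow> v \<in> U \<Longrightarrow> u \<bullet> v = (if u = v then 1 else 0)) \<Longrightarrow> card U \<le> n"
  obtains U where "finite U" "card U \<le> n" "span U = V"
    "\<And>u v. u \<in> U \<Longrightarrow> v \<in> U \<Longrightarrow> u \<bullet> v = (if u = v then 1 else 0)"
proof -
  define P where "P U \<longleftrightarrow> finite U \<and> U \<subseteq> V \<and> (\<forall>u\<in>U. \<forall>v\<in>U. u \<bullet> v = (if u = v then 1 else 0))" for U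
  have card_P: "card U \<le> n" if "P U" for U using bound[of U] that by (auto simp: P_def)
  have "P {}" by (simp add: P_def)
  then have "\<exists>U. P U \<and> (\<forall>U'. P U' \<longrightarrow> card U' \<le> card U)"
    using ex_has_greatest_nat[of P "{}" card "Suc n"] card_P by (simp add: less_Suc_eq_le)
  then obtain U where U: "P U" "\<And>U'. P U' \<Longrightarrow> card U' \<le> card U" by blast
  have "V \<subseteq> span U"
  proof
    fix v assume "v \<in> V"
    define r where "r = v - (\<Sum>u\<in>U. (v \<bullet> u) *\<^sub>R u)"
    have span: "(\<Sum>u\<in>U. (v \<bullet> u) *\<^sub>R u) \<in> span U" by (intro span_sum span_scale span_base)
    have orth: "r \<bullet> c = 0" if "c \<in> U" for c
    proof -
      have "(\<Sum>u\<in>U. (v \<bullet> u) *\<^sub>R u) \<bullet> c = (\<Sum>u\<in>U. if u = c then v \<bullet> c else 0)"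
        unfolding inner_sum_left using U(1) that by (intro sum.cong) (auto simp: P_def)
      then show ?thesis using U(1) that by (simp add: r_def inner_diff_left P_def)
    qed
    show "v \<in> span U"
    proof (cases "r = 0")
      case False
      define w where "w = (1 / norm r) *\<^sub>R r"
      have "span U \<subseteq> V" using U(1) assms(1) by (intro span_minimal) (auto simp: P_def)
      then have "w \<in> V" using span \<open>v \<in> V\<close> assms(1) unfolding w_def r_def
        by (intro subspace_scale subspace_diff) auto
      moreover have "w \<bullet> w = 1" using False by (simp add: w_def power2_eq_square flip: power2_norm_eq_inner)
      moreover have ortho_w: "w \<bullet> c = 0" "c \<bullet> w = 0" if "c \<in> U" for c
        using orth[OF that] by (simp_all add: w_def inner_commute)
      ultimately have "w \<notin> U" "P (insert w U)" using U(1) by (auto simp: P_def)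
      then have "Suc (card U) \<le> card U" using U(2)[of "insert w U"] U(1) by (simp add: P_def)
      then show ?thesis by simp
    qed (use span in \<open>simp add: r_def\<close>)
  qed
  moreover have "span U \<subseteq> V" using U(1) assms(1) by (intro span_minimal) (auto simp: P_def)
  ultimately have "span U = V" by (rule subset_antisym[rotated])
  moreover have "finite U" "card U \<le> n" using U(1) card_P by (simp_all add: P_def)
  moreover have "u \<bullet> v = (if u = v then 1 else 0)" if "u \<in> U" "v \<in> U" for u v
    using U(1) that unfolding P_def by blast
  ultimately show ?thesis by (intro that[of U])
qed

lemma orth_proj_selfadjoint:
  assumes "V \<in> subspaces_upto n"
  shows "orth_proj V x \<bullet> y = x \<bullet> orth_proj V y"
proof -
  obtain j where j: "V \<in> subspaces_of_dim j" using assms by (auto simp: subspaces_upto_def)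
  have "(x - orth_proj V x) \<bullet> orth_proj V y = 0" "(y - orth_proj V y) \<bullet> orth_proj V x = 0"
    using orth_proj_works[OF j] by (auto simp: orthogonal_def)
  then have "x \<bullet> orth_proj V y = orth_proj V x \<bullet> orth_proj V y"
    "y \<bullet> orth_proj V x = orth_proj V y \<bullet> orth_proj V x"
    by (simp_all add: inner_diff_left)
  then show ?thesis by (metis inner_commute)
qed

text \<open>
  The quadratic form of a projection only involves distances to the subspace, and these are measurable.
\<close>

lemma orth_proj_infdist:
  assumes "V \<in> subspaces_upto n"
  shows "orth_proj V x \<bullet> x = (norm x)\<^sup>2 - (infdist x V)\<^sup>2"
proof -
  obtain j where j: "V \<in> subspaces_of_dim j" using assms by (auto simp: subspaces_upto_def)
  have sub: "subspace V" using j by (auto simp: subspaces_of_dim_def)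
  note P = orth_proj_works[OF j]
  have ortho: "(x - orth_proj V x) \<bullet> v = 0" if "v \<in> V" for v
    using P(2)[OF that] by (simp add: orthogonal_def)
  have "norm (x - orth_proj V x) \<le> dist x v" if "v \<in> V" for v
  proof -
    have "(x - orth_proj V x) \<bullet> (orth_proj V x - v) = 0"
      using P(1) that sub by (intro ortho subspace_diff) auto
    then have "(norm (x - v))\<^sup>2 = (norm (x - orth_proj V x))\<^sup>2 + (norm (orth_proj V x - v))\<^sup>2"
      using norm_add_Pythagorean[of "x - orth_proj V x" "orth_proj V x - v"] by (simp add: orthogonal_def)
    then have "(norm (x - orth_proj V x))\<^sup>2 \<le> (norm (x - v))\<^sup>2" by simp
    from power2_le_imp_le[OF this] show ?thesis by (simp add: dist_norm)
  qed
  moreover have "V \<noteq> {}" using P(1) by auto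
  ultimately have "norm (x - orth_proj V x) \<le> infdist x V"
    by (simp add: infdist_notempty cINF_greatest)
  moreover have "infdist x V \<le> norm (x - orth_proj V x)"
    using infdist_le[OF P(1)] by (simp add: dist_norm)
  ultimately have d: "infdist x V = norm (x - orth_proj V x)" by simp
  show ?thesis
    using ortho[OF P(1)[of x]] unfolding d power2_norm_eq_inner
    by (simp add: inner_simps inner_commute)
qed

lemma orth_proj_orthonormal:
  assumes "finite U" and "\<And>u v. u \<in> U \<Longrightarrow> v \<in> U \<Longrightarrow> u \<bullet> v = (if u = v then 1 else 0)"
  shows "orth_proj (span U) x \<bullet> x = (\<Sum>u\<in>U. (x \<bullet> u)\<^sup>2)"
proof -
  have dim: "span U \<in> subspaces_of_dim (card U)"
  proof -
    have "independent U"
      using assms(2) by (intro pairwise_orthogonal_independent) (fastforce simp: pairwise_def orthogonal_def)+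
    then show ?thesis using assms(1) unfolding subspaces_of_dim_def by blast
  qed
  define y where "y = (\<Sum>u\<in>U. (x \<bullet> u) *\<^sub>R u)"
  have "orthogonal (x - y) v" if "v \<in> span U" for v
  proof (rule orthogonal_to_span[OF that])
    fix c assume "c \<in> U"
    have "y \<bullet> c = (\<Sum>u\<in>U. if u = c then x \<bullet> c else 0)"
      unfolding y_def inner_sum_left using assms(2) \<open>c \<in> U\<close> by (intro sum.cong) auto
    then show "orthogonal (x - y) c" using assms(1) \<open>c \<in> U\<close> by (simp add: orthogonal_def inner_diff_left)
  qed
  then have ortho_y: "\<forall>v\<in>span U. orthogonal (x - y) v" by blast
  have "y \<in> span U" unfolding y_def by (intro span_sum span_scale span_base)
  moreover have "\<forall>v\<in>span U. orthogonal (x - orth_proj (span U) x) v"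
    using orth_proj_works(2)[OF dim] by blast
  ultimately have "orth_proj (span U) x = y"
    using orth_proj_unique[OF subspace_span orth_proj_works(1)[OF dim] _ _ ortho_y] by blast
  then show ?thesis
    unfolding y_def inner_sum_left inner_scaleR_left power2_eq_square
    by (simp only: inner_sum_left inner_scaleR_left) (intro sum.cong refl, simp add: inner_commute)
qed

text \<open>
  For orthonormal vectors this is the projection onto their span. For almost orthonormal vectors it is not
  a projection, but still close to one in norm, which spares any orthonormalisation.
\<close>

definition rank_one_sum :: "'a::real_inner list \<Rightarrow> 'a \<Rightarrow>\<^sub>L 'a" where
  "rank_one_sum ds = Blinfun (\<lambda>x. \<Sum>i<length ds. (x \<bullet> ds ! i) *\<^sub>R ds ! i)"

lemma rank_one_sum: "rank_one_sum ds x = (\<Sum>i<length ds. (x \<bullet> ds ! i) *\<^sub>R ds ! i)"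
proof -
  have "bounded_linear (\<lambda>x. \<Sum>i<length ds. (x \<bullet> ds ! i) *\<^sub>R ds ! i)"
    by (intro bounded_linear_intros)
  then show ?thesis unfolding rank_one_sum_def by (simp add: bounded_linear_Blinfun_apply)
qed

lemma rank_one_sum_form: "rank_one_sum ds x \<bullet> x = (\<Sum>i<length ds. (x \<bullet> ds ! i)\<^sup>2)"
  unfolding rank_one_sum inner_sum_left inner_scaleR_left power2_eq_square
  by (intro sum.cong refl) (simp add: inner_commute)

lemma rank_one_sum_selfadjoint: "rank_one_sum ds x \<bullet> y = x \<bullet> rank_one_sum ds y"
  by (simp add: rank_one_sum inner_sum_left inner_sum_right inner_commute mult.commute)

lemma square_inner_diff_le:
  fixes x u d :: "'a::real_inner"
  assumes "norm u = 1" "dist u d \<le> \<delta>" "\<delta> \<le> 1"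
  shows "\<bar>(x \<bullet> u)\<^sup>2 - (x \<bullet> d)\<^sup>2\<bar> \<le> 3 * \<delta> * (norm x)\<^sup>2"
proof -
  have "(x \<bullet> u)\<^sup>2 - (x \<bullet> d)\<^sup>2 = (x \<bullet> (u - d)) * (x \<bullet> (u + d))"
    by (simp add: inner_simps power2_eq_square algebra_simps)
  then have "\<bar>(x \<bullet> u)\<^sup>2 - (x \<bullet> d)\<^sup>2\<bar> = \<bar>x \<bullet> (u - d)\<bar> * \<bar>x \<bullet> (u + d)\<bar>" by (simp add: abs_mult)
  also have "\<dots> \<le> (norm x * \<delta>) * (norm x * 3)"
  proof (intro mult_mono)
    have "norm (u - d) \<le> \<delta>" using assms(2) by (simp add: dist_norm)
    then show "\<bar>x \<bullet> (u - d)\<bar> \<le> norm x * \<delta>"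
      using Cauchy_Schwarz_ineq2[of x "u - d"] mult_left_mono[of "norm (u - d)" \<delta> "norm x"] by simp
    have "norm (u + d) = norm (2 *\<^sub>R u - (u - d))" by (simp add: scaleR_2)
    also have "\<dots> \<le> norm (2 *\<^sub>R u) + norm (u - d)" by (rule norm_triangle_ineq4)
    finally have "norm (u + d) \<le> 3" using assms(1,3) \<open>norm (u - d) \<le> \<delta>\<close> by simp
    then show "\<bar>x \<bullet> (u + d)\<bar> \<le> norm x * 3"
      using Cauchy_Schwarz_ineq2[of x "u + d"] mult_left_mono[of "norm (u + d)" 3 "norm x"] by simp
    show "0 \<le> norm x * \<delta>" using assms(2) by (intro mult_nonneg_nonneg) (auto intro: order_trans[OF zero_le_dist])
  qed simp
  finally show ?thesis by (simp add: power2_eq_square mult_ac)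
qed

context orthonormal_basis
begin

text \<open>
  The list \<open>\<kappa>\<close> of indices names a finite-rank operator whose quadratic form agrees with that of the
  projection onto the tangent space up to \<open>1 / Suc m\<close> on a dense sequence. There are countably many lists.
\<close>

definition code_approx :: "'a set \<Rightarrow> nat \<Rightarrow> nat list \<Rightarrow> 'a \<Rightarrow> bool" where
  "code_approx S m \<kappa> p \<longleftrightarrow> (\<forall>a. \<bar>(norm (supp_seq a p))\<^sup>2 - (infdist (supp_seq a p) (tangent_space S p))\<^sup>2
     - (\<Sum>i<length \<kappa>. (supp_seq a p \<bullet> supp_seq (\<kappa> ! i) p)\<^sup>2)\<bar> \<le> 1 / real (Suc m) * (norm (supp_seq a p))\<^sup>2)"

lemma code_approx_borel: "{p. code_approx S m \<kappa> p} \<in> sets borel"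
proof -
  have inner: "(\<lambda>p. supp_seq a p \<bullet> supp_seq b p) \<in> borel_measurable borel" for a b
  proof -
    have "sigma_locally_constant (\<lambda>p. supp_seq a p \<bullet> supp_seq b p)"
      using sigma_locally_constant_comp[OF sigma_locally_constant_pair[OF
        sigma_locally_constant_supp_seq[of a] sigma_locally_constant_supp_seq[of b]], of "\<lambda>(x, y). x \<bullet> y"]
      by simp
    from sigma_locally_constant_vimage[OF this] show ?thesis
      by (intro measurableI) (auto simp: vimage_def)
  qed
  have norm: "(\<lambda>p. (norm (supp_seq a p))\<^sup>2) \<in> borel_measurable borel" for a
    using inner[of a a] by (simp add: power2_norm_eq_inner)
  have dist: "(\<lambda>p. infdist (supp_seq a p) (tangent_space S p)) \<in> borel_measurable borel" for a
    by (rule infdist_tangent_space_borel[OF sigma_locally_constant_supp_seq])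
  note [measurable] = inner norm dist
  define T where "T a = {p \<in> space borel. \<bar>(norm (supp_seq a p))\<^sup>2 - (infdist (supp_seq a p) (tangent_space S p))\<^sup>2
     - (\<Sum>i<length \<kappa>. (supp_seq a p \<bullet> supp_seq (\<kappa> ! i) p)\<^sup>2)\<bar> \<le> 1 / real (Suc m) * (norm (supp_seq a p))\<^sup>2}" for a
  have "T a \<in> sets borel" for a unfolding T_def by measurable
  then have "(\<Inter>a. T a) \<in> sets borel" by (intro sets.countable_INT') auto
  moreover have "{p. code_approx S m \<kappa> p} = (\<Inter>a. T a)"
    by (simp add: code_approx_def T_def set_eq_iff)
  ultimately show ?thesis by simp
qed

lemma code_approx_norm:
  assumes V: "tangent_space S p \<in> subspaces_upto n" and approx: "code_approx S m \<kappa> p"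
  shows "norm (orth_proj (tangent_space S p) - rank_one_sum (map (\<lambda>k. supp_seq k p) \<kappa>)) \<le> 1 / Suc m"
proof -
  define A where "A = orth_proj (tangent_space S p) - rank_one_sum (map (\<lambda>k. supp_seq k p) \<kappa>)"
  obtain j where j: "tangent_space S p \<in> subspaces_of_dim j" using V by (auto simp: subspaces_upto_def)
  have "norm A \<le> 1 / Suc m"
  proof (rule norm_le_quadratic_form[OF _ supp_space_subspace[of p]])
    show "A x \<bullet> y = x \<bullet> A y" for x y
      using orth_proj_selfadjoint[OF V, of x y] rank_one_sum_selfadjoint[of _ x y]
      by (simp add: A_def blinfun.diff_left inner_diff_left inner_diff_right)
    show "range A \<subseteq> supp_space p"
    proof safe
      fix x
      have "orth_proj (tangent_space S p) x \<in> supp_space p"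
        using orth_proj_works(1)[OF j] tangent_space_supp by blast
      moreover have "rank_one_sum (map (\<lambda>k. supp_seq k p) \<kappa>) x \<in> supp_space p"
        unfolding rank_one_sum
        by (intro subspace_sum subspace_scale supp_space_subspace) (simp add: supp_seq_in)
      ultimately show "A x \<in> supp_space p"
        unfolding A_def blinfun.diff_left by (intro subspace_diff supp_space_subspace)
    qed
    show "\<bar>blinfun_apply A x \<bullet> x\<bar> \<le> 1 / real (Suc m) * (norm x)\<^sup>2" if x: "x \<in> supp_space p" for x
    proof -
      have seq: "\<bar>blinfun_apply A (supp_seq a p) \<bullet> supp_seq a p\<bar> \<le> 1 / real (Suc m) * (norm (supp_seq a p))\<^sup>2" for a
        using approx unfolding code_approx_def A_def blinfun.diff_left inner_diff_left
          orth_proj_infdist[OF V] rank_one_sum_form by simp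
      have "\<exists>a. dist x (supp_seq a p) < 1 / Suc k" for k
        using supp_seq_dense[OF x] by simp
      then obtain f where f: "\<And>k. dist x (supp_seq (f k) p) < 1 / Suc k" by metis
      have lim: "(\<lambda>k. supp_seq (f k) p) \<longlonglongrightarrow> x"
      proof (rule metric_LIMSEQ_I)
        fix r :: real assume "r > 0"
        then obtain N where N: "1 / Suc N < r" by (rule nat_approx_posE)
        have "dist (supp_seq (f k) p) x < r" if "k \<ge> N" for k
        proof -
          have "1 / real (Suc k) \<le> 1 / Suc N" using that by (simp add: frac_le)
          then show ?thesis using f[of k] N by (simp add: dist_commute)
        qed
        then show "\<exists>N. \<forall>k\<ge>N. dist (supp_seq (f k) p) x < r" by blast
      qed
      show ?thesis
      proof (rule LIMSEQ_le)
        show "(\<lambda>k. \<bar>blinfun_apply A (supp_seq (f k) p) \<bullet> supp_seq (f k) p\<bar>) \<longlonglongrightarrow> \<bar>blinfun_apply A x \<bullet> x\<bar>"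
          by (intro tendsto_intros lim)
        show "(\<lambda>k. 1 / real (Suc m) * (norm (supp_seq (f k) p))\<^sup>2) \<longlonglongrightarrow> 1 / real (Suc m) * (norm x)\<^sup>2"
          by (intro tendsto_intros lim)
        show "\<exists>N. \<forall>k\<ge>N. \<bar>blinfun_apply A (supp_seq (f k) p) \<bullet> supp_seq (f k) p\<bar> \<le> 1 / real (Suc m) * (norm (supp_seq (f k) p))\<^sup>2"
          using seq by blast
      qed
    qed
  qed simp
  then show ?thesis by (simp only: A_def)
qed

text \<open>
  Replacing one vector of an orthonormal basis of the tangent space by a term of the dense sequence at
  distance less than \<open>\<delta>\<close> changes the quadratic form at \<open>x\<close> by at most \<open>3 \<delta> (norm x)\<^sup>2\<close>.
\<close>

lemma code_approx_exists:
  assumes U: "finite U" "\<And>u v. u \<in> U \<Longrightarrow> v \<in> U \<Longrightarrow> u \<bullet> v = (if u = v then 1 else 0)"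
    and V: "span U = tangent_space S p"
  shows "\<exists>\<kappa>. code_approx S m \<kappa> p"
proof -
  have "tangent_space S p \<in> subspaces_upto (card U)"
    using subspaces_upto_orthonormal_span[OF U(1) order_refl U(2)] V by simp
  note form = orth_proj_infdist[OF this]
  obtain us where us: "set us = U" "distinct us" using finite_distinct_list[OF U(1)] by blast
  define \<delta> where "\<delta> = 1 / (3 * (real (length us) + 1) * Suc m)"
  have "\<delta> > 0" by (simp add: \<delta>_def)
  have "\<delta> \<le> 1" unfolding \<delta>_def by (simp add: divide_le_eq_1 algebra_simps add_pos_nonneg)
  have "\<forall>u\<in>U. \<exists>a. dist u (supp_seq a p) < \<delta>"
    using supp_seq_dense \<open>\<delta> > 0\<close> tangent_space_supp V span_superset by blast
  then obtain g where g: "\<And>u. u \<in> U \<Longrightarrow> dist u (supp_seq (g u) p) < \<delta>" by metis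
  have "code_approx S m (map g us) p"
    unfolding code_approx_def
  proof
    fix a
    define x where "x = supp_seq a p"
    have "(norm x)\<^sup>2 - (infdist x (tangent_space S p))\<^sup>2 = (\<Sum>u\<in>U. (x \<bullet> u)\<^sup>2)"
      using orth_proj_orthonormal[OF U] form V by simp
    also have "\<dots> = (\<Sum>i<length us. (x \<bullet> us ! i)\<^sup>2)"
      using us by (intro sum.reindex_bij_betw[symmetric] bij_betw_nth) auto
    finally have "\<bar>(norm x)\<^sup>2 - (infdist x (tangent_space S p))\<^sup>2
        - (\<Sum>i<length (map g us). (x \<bullet> supp_seq (map g us ! i) p)\<^sup>2)\<bar>
      = \<bar>\<Sum>i<length us. (x \<bullet> us ! i)\<^sup>2 - (x \<bullet> supp_seq (g (us ! i)) p)\<^sup>2\<bar>"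
      by (simp add: sum_subtractf)
    also have "\<dots> \<le> (\<Sum>i<length us. 3 * \<delta> * (norm x)\<^sup>2)"
    proof (rule order_trans[OF sum_abs sum_mono])
      fix i assume "i \<in> {..<length us}"
      then have "us ! i \<in> U" using us(1) by auto
      then show "\<bar>(x \<bullet> us ! i)\<^sup>2 - (x \<bullet> supp_seq (g (us ! i)) p)\<^sup>2\<bar> \<le> 3 * \<delta> * (norm x)\<^sup>2"
        using g[of "us ! i"] U(2)[of "us ! i" "us ! i"] \<open>\<delta> \<le> 1\<close>
        by (intro square_inner_diff_le) (auto simp: norm_eq_1)
    qed
    also have "\<dots> = (length us * (3 * \<delta>)) * (norm x)\<^sup>2" by simp
    also have "\<dots> \<le> 1 / real (Suc m) * (norm x)\<^sup>2"
    proof (intro mult_right_mono)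
      have "length us * (3 * \<delta>) \<le> (real (length us) + 1) * (3 * \<delta>)" using \<open>\<delta> > 0\<close> by simp
      also have "\<dots> = 1 / Suc m" by (simp add: \<delta>_def divide_simps)
      finally show "length us * (3 * \<delta>) \<le> 1 / Suc m" .
    qed simp
    finally show "\<bar>(norm (supp_seq a p))\<^sup>2 - (infdist (supp_seq a p) (tangent_space S p))\<^sup>2
        - (\<Sum>i<length (map g us). (supp_seq a p \<bullet> supp_seq (map g us ! i) p)\<^sup>2)\<bar>
      \<le> 1 / real (Suc m) * (norm (supp_seq a p))\<^sup>2"
      by (simp only: x_def)
  qed
  then show ?thesis by blast
qed

text \<open>
  Choosing the first code that works gives operators within \<open>1 / Suc m\<close> of the projections onto the
  tangent spaces, and these operators depend on \<open>p\<close> in a locally constant way on countably many Borel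
  pieces. Hence any condition on them is Borel, and for open \<open>U\<close> membership of the tangent space in \<open>U\<close> is
  a countable union of such conditions.
\<close>

lemma tangent_space_measurable:
  assumes dim: "\<And>p. p \<in> F \<Longrightarrow> tangent_space S p \<in> subspaces_upto n"
    and codes: "\<And>p m. p \<in> F \<Longrightarrow> \<exists>\<kappa>. code_approx S m \<kappa> p"
    and "F \<in> sets borel" and U: "openin (subspace_topology n) U"
  shows "{p\<in>F. tangent_space S p \<in> U} \<in> sets borel"
proof -
  interpret G: Metric_space "subspaces_upto n :: 'a set set" subspace_dist
    by (rule Metric_space_subspace_dist)
  define code where "code m p = (LEAST c. code_approx S m (from_nat c) p)" for m p
  define Q where "Q m p = rank_one_sum (map (\<lambda>k. supp_seq k p) (from_nat (code m p)))" for m p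
  have near: "norm (orth_proj (tangent_space S p) - Q m p) \<le> 1 / Suc m" if p: "p \<in> F" for m p
  proof -
    obtain \<kappa> where "code_approx S m \<kappa> p" using codes[OF p] by blast
    then have "code_approx S m (from_nat (to_nat \<kappa>)) p" by simp
    then have "code_approx S m (from_nat (code m p)) p" unfolding code_def by (rule LeastI)
    then show ?thesis unfolding Q_def by (rule code_approx_norm[OF dim[OF p]])
  qed
  have slc_Q: "sigma_locally_constant (Q m)" for m
  proof -
    have "code m \<in> measurable borel (count_space UNIV)"
      unfolding code_def using code_approx_borel by (intro measurable_Least) (simp add: pred_def)
    then have "{p. code m p = c} \<in> sets borel" for c
      using measurable_sets[of "code m" borel "count_space UNIV" "{c}"] by (simp add: vimage_def)
    then have code: "sigma_locally_constant (code m)" by (rule sigma_locally_constant_countable)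
    have "sigma_locally_constant (\<lambda>p. map (\<lambda>k. supp_seq k p) \<kappa>)" for \<kappa>
    proof (induction \<kappa>)
      case Nil
      show ?case by (simp add: sigma_locally_constant_const)
    next
      case (Cons k \<kappa>)
      from sigma_locally_constant_comp[OF sigma_locally_constant_pair[OF
          sigma_locally_constant_supp_seq[of k] Cons], of "\<lambda>(x, xs). x # xs"]
      show ?case by simp
    qed
    then have "sigma_locally_constant (\<lambda>p. rank_one_sum (map (\<lambda>k. supp_seq k p) (from_nat c)))" for c
      by (rule sigma_locally_constant_comp)
    from sigma_locally_constant_select[OF code this] show ?thesis by (simp add: Q_def[abs_def])
  qed
  \<comment> \<open>All subspaces whose projections are within \<open>1 / Suc m\<close> of the operator belong to \<open>U\<close>.\<close>
  define W where "W m = {A. \<forall>V\<in>subspaces_upto n. norm (orth_proj V - A) \<le> 1 / Suc m \<longrightarrow> V \<in> U}" for m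
  have "{p\<in>F. tangent_space S p \<in> U} = F \<inter> (\<Union>m. {p. Q m p \<in> W m})"
  proof (intro set_eqI iffI)
    fix p assume p: "p \<in> {p\<in>F. tangent_space S p \<in> U}"
    have "openin G.mtopology U" using U by (simp add: subspace_topology_def)
    then obtain r where r: "r > 0" "G.mball (tangent_space S p) r \<subseteq> U"
      using p unfolding G.openin_mtopology by blast
    obtain m where m: "1 / Suc m < r / 2" using nat_approx_posE[of "r / 2"] r(1) by auto
    have "Q m p \<in> W m"
      unfolding W_def
    proof (intro CollectI ballI impI)
      fix V assume V: "V \<in> subspaces_upto n" "norm (orth_proj V - Q m p) \<le> 1 / Suc m"
      have "subspace_dist (tangent_space S p) V
          \<le> norm (orth_proj (tangent_space S p) - Q m p) + norm (orth_proj V - Q m p)"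
        unfolding subspace_dist_def using norm_triangle_ineq4[of "orth_proj (tangent_space S p) - Q m p" "orth_proj V - Q m p"]
        by simp
      also have "\<dots> < r" using near[of p m] p V(2) m by simp
      finally have "V \<in> G.mball (tangent_space S p) r" using V(1) dim p by simp
      then show "V \<in> U" using r(2) by blast
    qed
    then show "p \<in> F \<inter> (\<Union>m. {p. Q m p \<in> W m})" using p by blast
  next
    fix p assume "p \<in> F \<inter> (\<Union>m. {p. Q m p \<in> W m})"
    then obtain m where "p \<in> F" "Q m p \<in> W m" by blast
    then show "p \<in> {p\<in>F. tangent_space S p \<in> U}" using near dim by (simp add: W_def)
  qed
  also have "\<dots> \<in> sets borel"
    using sigma_locally_constant_vimage[OF slc_Q] assms(3) by (intro sets.Int sets.countable_UN') auto
  finally show ?thesis .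
qed

end

section \<open>Tangents of curves\<close>

lemma arclength_parametrization_lipschitz:
  assumes "arclength_parametrization L \<gamma> \<Gamma>"
  shows "1-lipschitz_on {0..L} \<gamma>"
proof -
  have le: "dist (\<gamma> a) (\<gamma> b) \<le> b - a" if "0 \<le> a" "a \<le> b" "b \<le> L" for a b
  proof -
    define t where "t i = (if i = 0 then a else b)" for i :: nat
    have "ennreal (dist (\<gamma> a) (\<gamma> b)) = ennreal (\<Sum>i<1. dist (\<gamma> (t i)) (\<gamma> (t (Suc i))))"
      by (simp add: t_def)
    also have "\<dots> \<le> curve_length \<gamma> a b"
      unfolding curve_length_def
      by (rule SUP_upper2[of "(1, t)"]) (use that(2) in \<open>auto simp: t_def mono_on_def\<close>)
    also have "\<dots> = ennreal (b - a)"
      using assms that by (simp add: arclength_parametrization_def)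
    finally show ?thesis using that(2) by (simp add: ennreal_le_iff)
  qed
  show ?thesis
  proof (rule lipschitz_onI)
    fix s t assume "s \<in> {0..L}" "t \<in> {0..L}"
    then show "dist (\<gamma> s) (\<gamma> t) \<le> 1 * dist s t"
      using le[of s t] le[of t s] by (cases "s \<le> t") (auto simp: dist_real_def dist_commute)
  qed simp
qed

text \<open>
  Near a parameter \<open>t\<close> at which \<open>A\<close> has only small gaps, the points \<open>\<gamma> t + h v\<close> of the tangent line are
  approached by points of the curve with parameters in \<open>A\<close>.
\<close>

lemma curve_near_tangent:
  fixes \<gamma> :: "real \<Rightarrow> 'a::real_normed_vector"
  assumes lip: "1-lipschitz_on {0<..<L} \<gamma>" and A: "A \<subseteq> {0<..<L}" "t \<in> A"
    and full: "\<forall>e>0. \<forall>\<^sub>F h in at 0. infdist (t + h) A \<le> e * \<bar>h\<bar>"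
    and deriv: "(\<gamma> has_vector_derivative v) (at t)" and "\<rho> > 0"
  shows "\<forall>\<^sub>F h in at 0. \<exists>s\<in>A. norm (\<gamma> s - \<gamma> t - h *\<^sub>R v) \<le> \<rho> * \<bar>h\<bar>"
proof -
  have "((\<lambda>h. norm (\<gamma> (t + h) - \<gamma> t - h *\<^sub>R v) / norm h) \<longlongrightarrow> 0) (at 0)"
    using deriv unfolding has_vector_derivative_def has_derivative_at by blast
  then have "\<forall>\<^sub>F h in at 0. norm (\<gamma> (t + h) - \<gamma> t - h *\<^sub>R v) / norm h < \<rho> / 2"
    using \<open>\<rho> > 0\<close> by (intro order_tendstoD(2)) auto
  moreover have "\<forall>\<^sub>F h in at 0. infdist (t + h) A \<le> \<rho> / 4 * \<bar>h\<bar>"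
    by (rule full[rule_format]) (use \<open>\<rho> > 0\<close> in simp)
  moreover have "((\<lambda>h. t + h) \<longlongrightarrow> t) (at 0)" by (auto intro!: tendsto_eq_intros)
  then have "\<forall>\<^sub>F h in at 0. t + h \<in> {0<..<L}"
    using A by (intro topological_tendstoD) auto
  moreover have "\<forall>\<^sub>F h in at (0::real). h \<noteq> 0" by (simp add: eventually_at_filter)
  ultimately show ?thesis
  proof eventually_elim
    case (elim h)
    have "infdist (t + h) A < \<rho> / 2 * \<bar>h\<bar>"
    proof -
      have "0 < \<rho> * \<bar>h\<bar>" using elim(4) \<open>\<rho> > 0\<close> by simp
      then show ?thesis using elim(2) by simp
    qed
    moreover have "A \<noteq> {}" using A(2) by auto
    ultimately have "(INF s\<in>A. dist (t + h) s) < \<rho> / 2 * \<bar>h\<bar>" by (metis infdist_notempty)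
    then obtain s where s: "s \<in> A" "dist (t + h) s < \<rho> / 2 * \<bar>h\<bar>"
      using cInf_lessD[of "dist (t + h) ` A" "\<rho> / 2 * \<bar>h\<bar>"] A(2) by auto
    have "norm (\<gamma> (t + h) - \<gamma> t - h *\<^sub>R v) < \<rho> / 2 * \<bar>h\<bar>"
      using elim(1,4) by (simp add: divide_less_eq)
    moreover have "dist (\<gamma> s) (\<gamma> (t + h)) \<le> dist s (t + h)"
      using lipschitz_onD[OF lip, of s "t + h"] s(1) A(1) elim(3) by auto
    moreover have "norm (\<gamma> s - \<gamma> t - h *\<^sub>R v)
        \<le> norm (\<gamma> s - \<gamma> (t + h)) + norm (\<gamma> (t + h) - \<gamma> t - h *\<^sub>R v)"
      using norm_triangle_ineq[of "\<gamma> s - \<gamma> (t + h)" "\<gamma> (t + h) - \<gamma> t - h *\<^sub>R v"]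
      by (simp add: algebra_simps)
    ultimately have "norm (\<gamma> s - \<gamma> t - h *\<^sub>R v) \<le> \<rho> * \<bar>h\<bar>"
      using s(2) unfolding dist_commute[of "t + h" s] dist_norm[of "\<gamma> s"] by linarith
    then show ?case using s(1) by blast
  qed
qed

context orthonormal_basis
begin

lemma countable_curve_coords:
  fixes \<gamma> :: "real \<Rightarrow> 'a"
  assumes "continuous_on {0<..<L} \<gamma>"
  shows "countable {b\<in>B. \<exists>t\<in>{0<..<L}. \<gamma> t \<bullet> b \<noteq> 0}"
proof (rule countable_subset)
  show "countable (\<Union>s\<in>\<rat>. \<Union>j. large_coords (1 / real (Suc j)) (\<gamma> s))"
    using finite_large_coords by (intro countable_UN countable_rat) (auto intro: countable_finite)
  show "{b\<in>B. \<exists>t\<in>{0<..<L}. \<gamma> t \<bullet> b \<noteq> 0} \<subseteq> (\<Union>s\<in>\<rat>. \<Union>j. large_coords (1 / real (Suc j)) (\<gamma> s))"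
  proof clarify
    fix b t assume b: "b \<in> B" "t \<in> {0<..<L}" "\<gamma> t \<bullet> b \<noteq> 0"
    have "continuous_on {0<..<L} (\<lambda>s. \<gamma> s \<bullet> b)" by (intro continuous_intros assms)
    then have "open ((\<lambda>s. \<gamma> s \<bullet> b) -` (- {0}) \<inter> {0<..<L})"
      by (subst (asm) continuous_on_open_vimage) auto
    moreover have "t \<in> (\<lambda>s. \<gamma> s \<bullet> b) -` (- {0}) \<inter> {0<..<L}" using b by auto
    ultimately obtain d where d: "d > 0" "ball t d \<subseteq> (\<lambda>s. \<gamma> s \<bullet> b) -` (- {0}) \<inter> {0<..<L}"
      by (rule openE)
    obtain s where s: "s \<in> \<rat>" "t < s" "s < t + d"
      using Rats_dense_in_real[of t "t + d"] d(1) by auto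
    then have "s \<in> ball t d" by (simp add: dist_real_def)
    then have "0 < \<bar>\<gamma> s \<bullet> b\<bar>" using d(2) by auto
    then obtain j where "1 / Suc j < \<bar>\<gamma> s \<bullet> b\<bar>" by (rule nat_approx_posE)
    then have "b \<in> large_coords (1 / Suc j) (\<gamma> s)" using b(1) by (simp add: large_coords_def)
    then show "b \<in> (\<Union>s\<in>\<rat>. \<Union>j. large_coords (1 / real (Suc j)) (\<gamma> s))" using s(1) by blast
  qed
qed

lemma curve_countable_dense:
  fixes \<gamma> :: "real \<Rightarrow> 'a"
  assumes "continuous_on {0<..<L} \<gamma>"
  shows "\<exists>W. countable W \<and> (\<forall>t\<in>{0<..<L}. \<forall>w\<in>supp_space (\<gamma> t). \<forall>e>0. \<exists>w'\<in>W. dist w w' < e)"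
proof -
  define C where "C = {b\<in>B. \<exists>t\<in>{0<..<L}. \<gamma> t \<bullet> b \<noteq> 0}"
  have "countable C" unfolding C_def using assms by (rule countable_curve_coords)
  define W where "W = (\<lambda>(F, k). span_seq F k) ` ({F. finite F \<and> F \<subseteq> C} \<times> UNIV)"
  have "countable W"
    unfolding W_def using countable_Collect_finite_subset[OF \<open>countable C\<close>] by auto
  moreover have "\<exists>w'\<in>W. dist w w' < e" if t: "t \<in> {0<..<L}" and w: "w \<in> supp_space (\<gamma> t)" "e > 0" for t w e
  proof -
    obtain F u where F: "finite F" "F \<subseteq> {b\<in>B. \<gamma> t \<bullet> b \<noteq> 0}" "u \<in> span F" "dist w u < e/2"
      using supp_space_approx[OF w(1), of "e/2"] w(2) by auto
    obtain k where k: "dist u (span_seq F k) < e/2"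
      using span_seq(2)[OF F(1,3), of "e/2"] w(2) by auto
    have "F \<subseteq> C" using F(2) t by (auto simp: C_def)
    then have "span_seq F k \<in> W" using F(1) by (auto simp: W_def)
    moreover have "dist w (span_seq F k) < e"
      using F(4) k dist_triangle[of w "span_seq F k" u] by linarith
    ultimately show ?thesis by blast
  qed
  ultimately show ?thesis by (intro exI[of _ W]) blast
qed

text \<open>
  Outside a null set, \<open>t\<close> is not a porous point of any of countably many sets of parameters that contain it.
  For the zero sets of the coordinates this puts the derivative \<open>v\<close> into the support space. For the sets of
  parameters \<open>s\<close> where \<open>S\<close> deviates from \<open>\<gamma> s + \<real> w'\<close> at rate at most \<open>q\<close> up to a fixed scale, it lets one move along
  the curve by \<open>h v\<close> to such an \<open>s\<close> and leave it by \<open>h w'\<close>, with total error about \<open>q \<bar>h\<bar>\<close>. Thus \<open>v\<close> is a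
  period of the rate of deviation at \<open>\<gamma> t\<close>.
\<close>

lemma curve_derivative_in_tangent_space:
  fixes \<gamma> :: "real \<Rightarrow> 'a"
  assumes lip: "1-lipschitz_on {0<..<L} \<gamma>"
  shows "negligible {t\<in>{0<..<L}. \<exists>v. (\<gamma> has_vector_derivative v) (at t) \<and> v \<notin> tangent_space S (\<gamma> t)}"
proof -
  define porous where "porous A = {t\<in>A. \<not> (\<forall>e>0. \<forall>\<^sub>F h in at 0. infdist (t + h) A \<le> e * \<bar>h\<bar>)}"
    for A :: "real set"
  have cont: "continuous_on {0<..<L} \<gamma>" using lip by (rule lipschitz_on_continuous_on)
  obtain W where W: "countable W"
    "\<forall>t\<in>{0<..<L}. \<forall>w\<in>supp_space (\<gamma> t). \<forall>e>0. \<exists>w'\<in>W. dist w w' < e"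
    using curve_countable_dense[OF cont] by blast
  define C where "C = {b\<in>B. \<exists>t\<in>{0<..<L}. \<gamma> t \<bullet> b \<noteq> 0}"
  have "countable C" unfolding C_def using cont by (rule countable_curve_coords)
  define Z where "Z b = {t\<in>{0<..<L}. \<gamma> t \<bullet> b = 0}" for b
  define D where "D w q m = {t\<in>{0<..<L}. deviation_within S q m w (\<gamma> t)}" for w q m
  have neg: "negligible (porous A)" if "A \<subseteq> {0<..<L}" for A
    unfolding porous_def using bounded_subset[OF _ that] by (intro negligible_porous) auto
  define N where "N = (\<Union>b\<in>C. porous (Z b)) \<union> (\<Union>w\<in>W. \<Union>q\<in>\<rat>. \<Union>m. porous (D w q m))"
  have "negligible N"
    unfolding N_def using \<open>countable C\<close> W(1) countable_rat
    by (intro negligible_Un negligible_countable_Union countable_image)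
      (auto intro!: negligible_countable_Union neg simp: Z_def D_def)
  moreover have "v \<in> tangent_space S (\<gamma> t)"
    if t: "t \<in> {0<..<L}" "t \<notin> N" and deriv: "(\<gamma> has_vector_derivative v) (at t)" for t v
  proof -
    have "v \<bullet> b = 0" if b: "b \<in> B" "\<gamma> t \<bullet> b = 0" for b
    proof -
      have "\<forall>e>0. \<forall>\<^sub>F h in at 0. infdist (t + h) (Z b) \<le> e * \<bar>h\<bar>"
      proof (cases "b \<in> C")
        case True
        then show ?thesis using t b by (auto simp: N_def porous_def Z_def)
      next
        case False
        then have "Z b = {0<..<L}" using b(1) by (auto simp: Z_def C_def)
        moreover have "((\<lambda>h. t + h) \<longlongrightarrow> t) (at 0)" by (auto intro!: tendsto_eq_intros)
        then have "\<forall>\<^sub>F h in at 0. t + h \<in> {0<..<L}"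
          using t(1) by (intro topological_tendstoD) auto
        ultimately have "\<forall>\<^sub>F h in at 0. infdist (t + h) (Z b) = 0"
          by (simp add: infdist_zero eventually_mono)
        then show ?thesis by (auto elim: eventually_mono)
      qed
      note near = curve_near_tangent[OF lip _ _ this deriv]
      have "\<bar>v \<bullet> b\<bar> \<le> \<rho>" if "\<rho> > 0" for \<rho>
      proof -
        have "\<forall>\<^sub>F h in at 0. \<exists>s\<in>Z b. norm (\<gamma> s - \<gamma> t - h *\<^sub>R v) \<le> \<rho> * \<bar>h\<bar>"
          using t(1) b \<open>\<rho> > 0\<close> by (intro near) (auto simp: Z_def)
        moreover have "\<forall>\<^sub>F h in at (0::real). h \<noteq> 0" by (simp add: eventually_at_filter)
        ultimately have "\<forall>\<^sub>F h in at 0. h \<noteq> 0 \<and> (\<exists>s\<in>Z b. norm (\<gamma> s - \<gamma> t - h *\<^sub>R v) \<le> \<rho> * \<bar>h\<bar>)"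
          by eventually_elim simp
        from eventually_happens'[OF at_neq_bot this]
        obtain h s where hs: "h \<noteq> 0" "s \<in> Z b" "norm (\<gamma> s - \<gamma> t - h *\<^sub>R v) \<le> \<rho> * \<bar>h\<bar>"
          by blast
        have "\<bar>h\<bar> * \<bar>v \<bullet> b\<bar> = \<bar>(\<gamma> s - \<gamma> t - h *\<^sub>R v) \<bullet> b\<bar>"
          using hs(2) b(2) by (simp add: inner_diff_left Z_def abs_mult)
        also have "\<dots> \<le> norm (\<gamma> s - \<gamma> t - h *\<^sub>R v)"
          using Cauchy_Schwarz_ineq2[of "\<gamma> s - \<gamma> t - h *\<^sub>R v" b] unit[OF b(1)] by simp
        finally have "\<bar>h\<bar> * \<bar>v \<bullet> b\<bar> \<le> \<bar>h\<bar> * \<rho>" using hs(3) by (simp add: mult.commute)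
        then show ?thesis using hs(1) by simp
      qed
      then have "\<bar>v \<bullet> b\<bar> \<le> 0" by (rule dense_ge)
      then show ?thesis by simp
    qed
    then have supp: "v \<in> supp_space (\<gamma> t)" by (simp add: supp_space_def)
    have "shift_le S (\<gamma> t) 0 v"
      unfolding shift_le_def
    proof (intro conjI ballI allI impI)
      fix w e assume w: "w \<in> supp_space (\<gamma> t)" "deviation_le S (\<gamma> t) w e"
      show "deviation_le S (\<gamma> t) (w + v) (e + 0)"
        unfolding deviation_le_def
      proof (intro allI impI)
        fix e' assume "e + 0 < e'"
        \<comment> \<open>Two units of \<open>\<rho>\<close> go into the choice of \<open>q\<close>, one into replacing \<open>w\<close> by \<open>w'\<close> and one into leaving the tangent line.\<close>
        define \<rho> where "\<rho> = (e' - e) / 4"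
        have "\<rho> > 0" using \<open>e + 0 < e'\<close> by (simp add: \<rho>_def)
        obtain w' where w': "w' \<in> W" "dist w w' < \<rho>" using W(2) t(1) w(1) \<open>\<rho> > 0\<close> by blast
        obtain q where q: "q \<in> \<rat>" "e + \<rho> < q" "q < e + 2 * \<rho>"
          using Rats_dense_in_real[of "e + \<rho>" "e + 2 * \<rho>"] \<open>\<rho> > 0\<close> by auto
        have "e + dist w w' < q" using w'(2) q(2) by simp
        then have "\<forall>\<^sub>F h in at 0. infdist (\<gamma> t + h *\<^sub>R w') S \<le> q * \<bar>h\<bar>"
          using deviation_le_perturb[OF w(2), of w'] unfolding deviation_le_def by blast
        then obtain m where m: "deviation_within S q m w' (\<gamma> t)"
          using eventually_deviation_within by blast
        have D: "D w' q m \<subseteq> {0<..<L}" "t \<in> D w' q m" using m t(1) by (auto simp: D_def)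
        have "t \<notin> porous (D w' q m)" using t(2) w'(1) q(1) by (auto simp: N_def)
        then have "\<forall>e>0. \<forall>\<^sub>F h in at 0. infdist (t + h) (D w' q m) \<le> e * \<bar>h\<bar>"
          using D(2) unfolding porous_def by blast
        then have "\<forall>\<^sub>F h in at 0. \<exists>s\<in>D w' q m. norm (\<gamma> s - \<gamma> t - h *\<^sub>R v) \<le> \<rho> * \<bar>h\<bar>"
          using curve_near_tangent[OF lip D _ deriv \<open>\<rho> > 0\<close>] by blast
        moreover have "\<forall>\<^sub>F h in at (0::real). h \<noteq> 0" by (simp add: eventually_at_filter)
        moreover have "\<forall>\<^sub>F h in at (0::real). \<bar>h\<bar> < 1 / Suc m"
          by (auto simp: eventually_at intro!: exI[of _ "1 / Suc m"])
        ultimately show "\<forall>\<^sub>F h in at 0. infdist (\<gamma> t + h *\<^sub>R (w + v)) S \<le> e' * \<bar>h\<bar>"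
        proof eventually_elim
          case (elim h)
          then obtain s where s: "s \<in> D w' q m" "norm (\<gamma> s - \<gamma> t - h *\<^sub>R v) \<le> \<rho> * \<bar>h\<bar>" by blast
          have "infdist (\<gamma> s + h *\<^sub>R w') S \<le> q * \<bar>h\<bar>"
            using s(1) elim(2,3) by (simp add: D_def deviation_within_def)
          moreover have "infdist (\<gamma> t + h *\<^sub>R (w + v)) S
              \<le> infdist (\<gamma> s + h *\<^sub>R w') S + dist (\<gamma> t + h *\<^sub>R (w + v)) (\<gamma> s + h *\<^sub>R w')"
            by (rule infdist_triangle)
          moreover have "dist (\<gamma> t + h *\<^sub>R (w + v)) (\<gamma> s + h *\<^sub>R w') \<le> \<rho> * \<bar>h\<bar> + \<rho> * \<bar>h\<bar>"
          proof -
            have "dist (\<gamma> t + h *\<^sub>R (w + v)) (\<gamma> s + h *\<^sub>R w') = norm (h *\<^sub>R (w - w') - (\<gamma> s - \<gamma> t - h *\<^sub>R v))"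
              by (simp add: dist_norm algebra_simps)
            also have "\<dots> \<le> norm (h *\<^sub>R (w - w')) + norm (\<gamma> s - \<gamma> t - h *\<^sub>R v)"
              by (rule norm_triangle_ineq4)
            also have "norm (h *\<^sub>R (w - w')) \<le> \<rho> * \<bar>h\<bar>"
              using mult_left_mono[of "norm (w - w')" \<rho> "\<bar>h\<bar>"] w'(2) by (simp add: dist_norm mult.commute)
            finally show ?thesis using s(2) by simp
          qed
          ultimately have "infdist (\<gamma> t + h *\<^sub>R (w + v)) S \<le> (q + 2 * \<rho>) * \<bar>h\<bar>"
            by (simp add: algebra_simps)
          also have "\<dots> \<le> e' * \<bar>h\<bar>"
          proof (rule mult_right_mono)
            have "4 * \<rho> = e' - e" by (simp add: \<rho>_def)
            then show "q + 2 * \<rho> \<le> e'" using q(3) by linarith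
          qed simp
          finally show ?case .
        qed
      qed
    qed (rule supp)
    then show ?thesis by (simp add: tangent_space_def)
  qed
  ultimately show ?thesis by (elim negligible_subset) blast
qed

lemma nagata_dim_tangent_space:
  assumes "nagata_dim S \<le> enat n" "p \<in> closure S"
  obtains U where "finite U" "card U \<le> n" "span U = tangent_space S p"
    "\<And>u v. u \<in> U \<Longrightarrow> v \<in> U \<Longrightarrow> u \<bullet> v = (if u = v then 1 else 0)"
proof (rule orthonormal_sets_bounded_span[OF subspace_tangent_space])
  fix U :: "'a set"
  assume U: "finite U" "U \<subseteq> tangent_space S p"
    "\<And>u v. u \<in> U \<Longrightarrow> v \<in> U \<Longrightarrow> u \<bullet> v = (if u = v then 1 else 0)"
  show "card U \<le> n"
  proof (rule ccontr)
    assume "\<not> card U \<le> n"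
    then have "card {..n} \<le> card U" by simp
    then obtain v where v: "inj_on v {..n}" "v ` {..n} \<subseteq> U"
      using U(1) card_le_inj[of "{..n}" U] by auto
    have "S \<noteq> {}" using assms(2) by auto
    show False
    proof (rule nagata_dim_flat_bound[OF assms(1) \<open>S \<noteq> {}\<close>])
      show "v i \<bullet> v j = (if i = j then 1 else 0)" if "i \<le> n" "j \<le> n" for i j
      proof -
        have "v i \<in> U" "v j \<in> U" using v(2) that by auto
        moreover have "v i = v j \<longleftrightarrow> i = j" using inj_on_eq_iff[OF v(1)] that by simp
        ultimately show ?thesis using U(3) by presburger
      qed
      show "deviation_le S p (\<Sum>i\<le>n. x i *\<^sub>R v i) 0" for x :: "nat \<Rightarrow> real"
        using v(2) U(2) subspace_tangent_space
        by (intro tangent_space_flat assms(2) subspace_sum subspace_scale) auto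
    qed
  qed
qed (rule that)

end

theorem corollary1p5:
  fixes E :: "'a::{real_inner, banach} set" and n :: nat and \<E> :: "'a set set"
  assumes "n \<ge> 1"
    and "E \<in> sets borel"
    and "countable \<E>" and "E = \<Union>\<E>"
    and "\<And>S. S \<in> \<E> \<Longrightarrow> nagata_dim S \<le> enat n"
  shows "\<exists>\<tau>. weak_tangent_field n E \<tau>"
proof -
  obtain B :: "'a set" where "pairwise orthogonal B" "\<forall>b\<in>B. norm b = 1" "closure (span B) = UNIV"
    using orthonormal_basis_exists by blast
  then interpret orthonormal_basis B by unfold_locales auto
  \<comment> \<open>The empty set is added so that the enumeration exists for an empty family; no point lies in its closure.\<close>
  define S where "S = from_nat_into (insert {} \<E>)"
  have range_S: "range S = insert {} \<E>"
    unfolding S_def using assms(3) by (intro range_from_nat_into) auto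
  have nagata: "nagata_dim (S i) \<le> enat n" if "p \<in> closure (S i)" for i p
  proof -
    have "S i \<in> insert {} \<E>" using range_S by blast
    moreover have "S i \<noteq> {}" using that by auto
    ultimately show ?thesis using assms(5) by blast
  qed
  define idx where "idx p = (LEAST i. p \<in> closure (S i))" for p
  have idx: "p \<in> closure (S (idx p))" if p: "p \<in> E" for p
  proof -
    obtain i where "p \<in> S i" using p range_S assms(4) by (metis UnionE insertCI rangeE)
    then have "p \<in> closure (S i)" using closure_subset by blast
    then show ?thesis unfolding idx_def by (rule LeastI)
  qed
  define \<tau> where "\<tau> p = tangent_space (S (idx p)) p" for p
  have dim: "tangent_space (S i) p \<in> subspaces_upto n" if p: "p \<in> closure (S i)" for i p
    using nagata_dim_tangent_space[OF nagata[OF p] p] subspaces_upto_orthonormal_span by metis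
  have codes: "\<exists>\<kappa>. code_approx (S i) m \<kappa> p" if p: "p \<in> closure (S i)" for i m p
    using nagata_dim_tangent_space[OF nagata[OF p] p] code_approx_exists by metis
  define F where "F i = closure (S i) - (\<Union>j<i. closure (S j))" for i
  have F_idx: "p \<in> F i \<longleftrightarrow> i = idx p" if p: "p \<in> E" for p i
  proof
    assume "p \<in> F i"
    then show "i = idx p" unfolding idx_def F_def
      by (intro Least_equality[symmetric]) (auto simp: not_less[symmetric])
  next
    assume "i = idx p"
    then show "p \<in> F i" using idx[OF p] not_less_Least by (auto simp: F_def idx_def)
  qed
  have measurable: "\<tau> \<in> measurable (restrict_space borel E) (subspace_borel n)"
    unfolding subspace_borel_def
  proof (rule measurable_measure_of)
    interpret G: Metric_space "subspaces_upto n :: 'a set set" subspace_dist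
      by (rule Metric_space_subspace_dist)
    show "{U. openin (subspace_topology n) U} \<subseteq> Pow (subspaces_upto n :: 'a set set)"
      using openin_subset unfolding subspace_topology_def by fastforce
    show "\<tau> \<in> space (restrict_space borel E) \<rightarrow> subspaces_upto n"
      using dim idx by (auto simp: \<tau>_def space_restrict_space)
    fix U :: "'a set set" assume "U \<in> {U. openin (subspace_topology n) U}"
    then have U: "openin (subspace_topology n) U" by simp
    have "F i \<in> sets borel" for i unfolding F_def by (intro sets.Diff sets.finite_UN) auto
    then have "{p\<in>F i. tangent_space (S i) p \<in> U} \<in> sets borel" for i
      using dim codes by (intro tangent_space_measurable[OF _ _ _ U]) (auto simp: F_def)
    then have "E \<inter> (\<Union>i. {p\<in>F i. tangent_space (S i) p \<in> U}) \<in> sets borel"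
      using assms(2) by (intro sets.Int sets.countable_UN') auto
    moreover have "\<tau> -` U \<inter> E = E \<inter> (\<Union>i. {p\<in>F i. tangent_space (S i) p \<in> U})"
      using F_idx by (auto simp: \<tau>_def)
    ultimately show "\<tau> -` U \<inter> space (restrict_space borel E) \<in> sets (restrict_space borel E)"
      using assms(2) by (simp add: sets_restrict_space_iff space_restrict_space)
  qed
  have "hausdorff1 {p \<in> \<Gamma> \<inter> E. \<not> tangent_line L \<gamma> p \<subseteq> \<tau> p} = 0"
    if \<gamma>: "arclength_parametrization L \<gamma> \<Gamma>" for \<Gamma> L \<gamma>
  proof -
    define bad where "bad = {p \<in> \<Gamma> \<inter> E. \<not> tangent_line L \<gamma> p \<subseteq> \<tau> p}"
    have lip: "1-lipschitz_on {0<..<L} \<gamma>"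
      using arclength_parametrization_lipschitz[OF \<gamma>] by (rule lipschitz_on_subset) auto
    define N where "N = {t\<in>{0<..<L}. \<exists>i v. (\<gamma> has_vector_derivative v) (at t) \<and> v \<notin> tangent_space (S i) (\<gamma> t)}"
    have "N = (\<Union>i. {t\<in>{0<..<L}. \<exists>v. (\<gamma> has_vector_derivative v) (at t) \<and> v \<notin> tangent_space (S i) (\<gamma> t)})"
      by (auto simp: N_def)
    then have "negligible N"
      using curve_derivative_in_tangent_space[OF lip] by (simp add: negligible_Union_nat)
    define N' where "N' = {t\<in>N. \<gamma> t \<in> bad}"
    have "bad \<subseteq> \<gamma> ` N'"
    proof
      fix p assume p: "p \<in> bad"
      have "\<exists>v\<in>{v. \<exists>t\<in>{0<..<L}. \<gamma> t = p \<and> (\<gamma> has_vector_derivative v) (at t)}. v \<notin> \<tau> p"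
      proof (rule ccontr)
        assume "\<not> ?thesis"
        then have "tangent_line L \<gamma> p \<subseteq> \<tau> p"
          unfolding tangent_line_def \<tau>_def by (intro span_minimal subspace_tangent_space) auto
        then show False using p by (simp add: bad_def)
      qed
      then obtain v t where "t \<in> {0<..<L}" "\<gamma> t = p" "(\<gamma> has_vector_derivative v) (at t)" "v \<notin> \<tau> p"
        by blast
      then have "t \<in> N'" using p by (auto simp: N'_def N_def \<tau>_def)
      then show "p \<in> \<gamma> ` N'" using \<open>\<gamma> t = p\<close> by blast
    qed
    then have "bad = \<gamma> ` N'" by (auto simp: N'_def)
    moreover have "negligible N'" using \<open>negligible N\<close> by (rule negligible_subset) (auto simp: N'_def)
    moreover have "1-lipschitz_on N' \<gamma>"
      using lip by (rule lipschitz_on_subset) (auto simp: N'_def N_def)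
    ultimately show ?thesis using hausdorff1_lipschitz_image_negligible by (metis bad_def)
  qed
  then show ?thesis using measurable unfolding weak_tangent_field_def by blast
qed

end
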